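(* Let $\Phi$ be an optimality criterion satisfying Assumption A, and suppose that the single-covariate model satisfies one of the conditions (a)–(d) of the Complete Class Hypothesis (Assumption A and the Complete Class Hypothesis are defined in the context), with corresponding integer $m$, complete class $\Xi$, and objective function $\tilde\Phi(\mathbf Z)$. Then for any feasible critical point $\mathbf Z^c$ of $\tilde\Phi(\mathbf Z)$, the design corresponding to $\mathbf Z^c$ is a $\Phi$-optimal design (i.e. it maximizes $\Phi(\mathbf M_\xi(\boldsymbol\theta))$ over all designs $\xi$ on $[L,U]$).
   Context: **Model and designs.** The design space is an interval $[L,U]\subseteq\mathbb R$ ($L=-\infty$ or $U=\infty$ is allowed, $[L,U]$ then being half open or open). The unknown parameter is $\boldsymbol\theta\in\mathbb R^d$; a value of $\boldsymbol\theta$ is fixed throughout (local optimality). The model is a polynomial or nonlinear regression model or a generalized linear model with univariate response and one covariate $x\in[L,U]$; $\mathbf M_x(\boldsymbol\theta)$ denotes the $d\times d$ nonnegative definite Fisher information matrix of a single observation at $x$. It has the form $w(x)\,\mathbf f(x)\mathbf f(x)^T$, where $\mathbf f(x)=\partial\eta(x,\boldsymbol\theta)/\partial\boldsymbol\theta$, $\eta$ is the mean response (regression) or linear predictor (generalized linear model), and $w\ge 0$ is a scalar weight ($w\equiv1$ for regression with unit variance). A (approximate) design is $\xi=\{(x_i,\omega_i)\}_{i=1}^q$ with $x_i\in[L,U]$, $\omega_i\ge0$, $\sum_i\omega_i=1$; the $x_i$ are design points, those with positive weight are support points, and the number of support points is the support size. Its information matrix is $\mathbf M_\xi(\boldsymbol\theta)=\sum_i\omega_i\mathbf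 M_{x_i}(\boldsymbol\theta)$. **Assumption A.** Let NND$(d)$ and PD$(d)$ be the sets of $d\times d$ nonnegative definite and positive definite matrices. $\Phi$ is a nonnegative, nonconstant real function on NND$(d)$ that is (1) concave; (2) isotonic: $\Phi(\mathbf M_1)\ge\Phi(\mathbf M_2)$ whenever $\mathbf M_1\ge\mathbf M_2$ in the Loewner order; (3) smooth on PD$(d)$: differentiable with continuous first-order partial derivatives, as a function of the $d(d+1)/2$ upper-triangular entries. **Complete Class Hypothesis.** There is a decomposition $\mathbf M_x(\boldsymbol\theta)=\mathbf P\,\mathbf C(c(x))\,\mathbf P^T$, where $\mathbf P$ is a nonsingular $d\times d$ matrix depending only on $\boldsymbol\theta$, $c$ is a smooth strictly monotone transformation of $[L,U]$ onto an interval $[A,B]$ (so $A,B$ correspond to $L,U$ if $c$ is increasing and to $U,L$ if $c$ is decreasing), and $\mathbf C(c)=(\Psi_{ij}(c))$ is a symmetric $d\times d$ matrix function. For some $1\le d_1<d$, let $\mathbf C_{22}(c)$ be the lower $d_1\times d_1$ principal submatrix of $\mathbf C(c)$; let $\Psi_1,\dots,\Psi_{k-1}$ be a maximal set of linearly independent nonconstant functions among the entries of the first $d-d_1$ columns of $\mathbf C(c)$; put $\Psi_k=\mathbf C_{22}$ (matrix valued). Define $f_{\ell,1}=\Psi_\ell'$ for $1\le\ell\le k$ and $f_{\ell,t}=(f_{\ell,t-1}/f_{t-1,t-1})'$ for $2\le t\le\ell\le k$ (entrywise derivatives when $\ell=k$; all derivatives are assumed to exist), and $\mathbf F(c)=\prod_{\ell=1}^k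 f_{\ell,\ell}(c)$, a $d_1\times d_1$ matrix. One of the following holds, where $\mathbf F>0$ (resp. $\mathbf F<0$) means that $\mathbf F(c)$ (resp. $-\mathbf F(c)$) is positive definite for all $c\in[A,B]$: (a) $k=2m-1$ and $\mathbf F<0$; then $\Xi$ is the set of designs with at most $m$ design points including the point corresponding to $A$; (b) $k=2m-1$ and $\mathbf F>0$; then $\Xi$ is the set of designs with at most $m$ design points including the point corresponding to $B$; (c) $k=2m$ and $\mathbf F<0$; then $\Xi$ is the set of designs with at most $m$ design points; (d) $k=2m-2$ and $\mathbf F>0$; then $\Xi$ is the set of designs with at most $m$ design points including both endpoints. By a known theorem of Yang and Stufken (2012), $\Xi$ is a complete class: for every design $\xi$ there is $\tilde\xi\in\Xi$ with $\mathbf M_{\tilde\xi}(\boldsymbol\theta)\ge\mathbf M_\xi(\boldsymbol\theta)$. The required endpoints are called fixed design points (they may carry weight $0$), and $\mathrm{fix}(\Xi)\subseteq\{L,U\}$ denotes the set of fixed design points, expressed in the $x$ variable. It is understood that $m\ge d$. **Objective function and critical points.** Designs in $\Xi$ are written $\xi=\{(x_i,\omega_i)\}_{i=1}^m$ with $x_1<\dots<x_m$ ($x_1=L$ if $L\in\mathrm{fix}(\Xi)$, $x_m=U$ if $U\in\mathrm{fix}(\Xi)$), $\omega_i\ge0$, $\omega_1=1-\sum_{i=2}^m\omega_i$. $\mathbf Z$ is the vector of the non-fixed design points together with $\omega_2,\dots,\omega_m$, and $\tilde\Phi(\mathbf Z)=\Phi(\mathbf M_\xi(\boldsymbol\theta))$.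 A critical point $\mathbf Z^c$ of $\tilde\Phi$ (a point where the gradient vanishes) is a *feasible critical point* if all design points in $\mathbf Z^c$ lie in $[L,U]$ and all $m-1$ weights in $\mathbf Z^c$ are positive with sum less than $1$.
   Formalization: The transformation c is additionally required to have nonzero derivative at every point of [L,U] that is not a fixed design point; for c(x)=x³ a design point at 0 is trivially stationary and the claim as stated fails. *)

theory Defs
  imports "HOL-Analysis.Analysis"
begin

section \<open>Nonnegative definite matrices and optimality criteria\<close>

definition NND :: "(real^'n^'n) set" where
  "NND = {A. transpose A = A \<and> (\<forall>v. 0 \<le> v \<bullet> (A *v v))}"

definition PD :: "(real^'n^'n) set" where
  "PD = {A. transpose A = A \<and> (\<forall>v. v \<noteq> 0 \<longrightarrow> 0 < v \<bullet> (A *v v))}"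

definition loewner_le :: "real^'n^'n \<Rightarrow> real^'n^'n \<Rightarrow> bool" where
  "loewner_le A B \<longleftrightarrow> B - A \<in> NND"

text \<open>The symmetric matrix with ones in the positions \<open>(i,j)\<close> and \<open>(j,i)\<close> only. For a function on
  symmetric matrices, the partial derivative with respect to the upper-triangular entry \<open>(i,j)\<close> is
  the directional derivative in this direction.\<close>

definition sym_unit :: "'n \<Rightarrow> 'n \<Rightarrow> real^'n^'n" where
  "sym_unit i j = (\<chi> a b. if (a = i \<and> b = j) \<or> (a = j \<and> b = i) then 1 else 0)"

text \<open>\<open>PD\<close> is open in the space of symmetric matrices, so the derivative within \<open>PD\<close> is the
  derivative as a function of the upper-triangular entries.\<close>

definition smooth_on_PD :: "(real^'n^'n \<Rightarrow> real) \<Rightarrow> bool" where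
  "smooth_on_PD \<Phi> \<longleftrightarrow>
     (\<exists>D. (\<forall>A\<in>PD. (\<Phi> has_derivative D A) (at A within PD)) \<and>
          (\<forall>i j. continuous_on PD (\<lambda>A. D A (sym_unit i j))))"

definition optimality_criterion :: "(real^'n^'n \<Rightarrow> real) \<Rightarrow> bool" where
  "optimality_criterion \<Phi> \<longleftrightarrow>
     (\<forall>A\<in>NND. 0 \<le> \<Phi> A) \<and>
     \<not> \<Phi> constant_on NND \<and>
     concave_on NND \<Phi> \<and>
     (\<forall>A\<in>NND. \<forall>B\<in>NND. loewner_le A B \<longrightarrow> \<Phi> A \<le> \<Phi> B) \<and>
     smooth_on_PD \<Phi>"


section \<open>Model and designs\<close>

definition design_space :: "ereal \<Rightarrow> ereal \<Rightarrow> real set" where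
  "design_space L U = {x. L \<le> ereal x \<and> ereal x \<le> U}"

text \<open>\<open>\<eta> x \<theta>\<close> is the mean response (regression) or the linear predictor (generalized linear model),
  \<open>f x\<close> its gradient in the parameter, and \<open>w\<close> the weight (constantly one for regression with unit
  variance).\<close>

definition model ::
  "real set \<Rightarrow> (real \<Rightarrow> real^'n \<Rightarrow> real) \<Rightarrow> real^'n \<Rightarrow> (real \<Rightarrow> real^'n) \<Rightarrow> (real \<Rightarrow> real) \<Rightarrow> bool" where
  "model X \<eta> \<theta> f w \<longleftrightarrow> (\<forall>x\<in>X. (GDERIV (\<eta> x) \<theta> :> f x) \<and> 0 \<le> w x)"

definition fisher_info :: "(real \<Rightarrow> real) \<Rightarrow> (real \<Rightarrow> real^'n) \<Rightarrow> real \<Rightarrow> real^'n^'n" where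
  "fisher_info w f x = w x *\<^sub>R (\<chi> i j. f x $ i * f x $ j)"

text \<open>A design is a list of pairs (design point, weight). Points may carry weight zero.\<close>

type_synonym design = "(real \<times> real) list"

definition designs :: "real set \<Rightarrow> design set" where
  "designs X = {\<xi>. (\<forall>(x, \<omega>)\<in>set \<xi>. x \<in> X \<and> 0 \<le> \<omega>) \<and> (\<Sum>(x, \<omega>)\<leftarrow>\<xi>. \<omega>) = 1}"

definition info_matrix :: "(real \<Rightarrow> real^'n^'n) \<Rightarrow> design \<Rightarrow> real^'n^'n" where
  "info_matrix M \<xi> = (\<Sum>(x, \<omega>)\<leftarrow>\<xi>. \<omega> *\<^sub>R M x)"

definition optimal_design ::
  "real set \<Rightarrow> (real \<Rightarrow> real^'n^'n) \<Rightarrow> (real^'n^'n \<Rightarrow> real) \<Rightarrow> design \<Rightarrow> bool" where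
  "optimal_design X M \<Phi> \<xi> \<longleftrightarrow>
     \<xi> \<in> designs X \<and> (\<forall>\<zeta>\<in>designs X. \<Phi> (info_matrix M \<zeta>) \<le> \<Phi> (info_matrix M \<xi>))"


section \<open>The complete class hypothesis\<close>

definition lin_indep_on :: "real set \<Rightarrow> nat set \<Rightarrow> (nat \<Rightarrow> real \<Rightarrow> real) \<Rightarrow> bool" where
  "lin_indep_on I S g \<longleftrightarrow>
     (\<forall>a. (\<forall>s\<in>I. (\<Sum>l\<in>S. a l * g l s) = 0) \<longrightarrow> (\<forall>l\<in>S. a l = 0))"

text \<open>The rows and columns of a \<open>d \<times> d\<close> matrix are indexed by \<open>'p + 'q\<close> with \<open>d\<^sub>1 = CARD('q)\<close>: the
  indices \<open>Inl _\<close> are the first \<open>d - d\<^sub>1\<close> ones and the indices \<open>Inr _\<close> the last \<open>d\<^sub>1\<close> ones. As types are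
  nonempty, \<open>1 \<le> d\<^sub>1 < d\<close>.\<close>

definition lower_block :: "real^('p::finite + 'q::finite)^('p + 'q) \<Rightarrow> real^'q^'q" where
  "lower_block A = (\<chi> i j. A $ Inr i $ Inr j)"

text \<open>\<open>\<Psi> 1, \<dots>, \<Psi> (k - 1)\<close> is a maximal linearly independent family of nonconstant functions (on the
  interval \<open>I\<close>) among the entries of the first \<open>d - d\<^sub>1\<close> columns.\<close>

definition maximal_indep_entries ::
  "real set \<Rightarrow> (real \<Rightarrow> real^('p::finite + 'q::finite)^('p + 'q)) \<Rightarrow> nat \<Rightarrow> (nat \<Rightarrow> real \<Rightarrow> real) \<Rightarrow> bool" where
  "maximal_indep_entries I C k \<Psi> \<longleftrightarrow>
     (\<forall>l\<in>{1..<k}. \<not> \<Psi> l constant_on I \<and> (\<exists>i j. \<forall>s\<in>I. \<Psi> l s = C s $ i $ Inl j)) \<and>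
     lin_indep_on I {1..<k} \<Psi> \<and>
     (\<forall>i j. \<not> (\<lambda>s. C s $ i $ Inl j) constant_on I \<longrightarrow>
        \<not> lin_indep_on I {1..k} (\<Psi>(k := \<lambda>s. C s $ i $ Inl j)))"

text \<open>\<open>h l t\<close> stands for the scalar functions \<open>f\<^bsub>l,t\<^esub>\<close> with \<open>l < k\<close>, and \<open>H t\<close> for the matrix valued
  \<open>f\<^bsub>k,t\<^esub>\<close>. They are determined on \<open>I\<close> by this relation, which also says that all derivatives
  exist (one-sided at endpoints belonging to \<open>I\<close>).\<close>

definition derivative_chain ::
  "real set \<Rightarrow> nat \<Rightarrow> (nat \<Rightarrow> real \<Rightarrow> real) \<Rightarrow> (real \<Rightarrow> real^'q^'q) \<Rightarrow>
   (nat \<Rightarrow> nat \<Rightarrow> real \<Rightarrow> real) \<Rightarrow> (nat \<Rightarrow> real \<Rightarrow> real^'q^'q) \<Rightarrow> bool" where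
  "derivative_chain I k \<Psi> \<Psi>k h H \<longleftrightarrow>
     (\<forall>l\<in>{1..<k}. \<forall>s\<in>I. (\<Psi> l has_real_derivative h l 1 s) (at s within I)) \<and>
     (\<forall>l\<in>{1..<k}. \<forall>t\<in>{2..l}. \<forall>s\<in>I.
        ((\<lambda>u. h l (t - 1) u / h (t - 1) (t - 1) u) has_real_derivative h l t s) (at s within I)) \<and>
     (\<forall>s\<in>I. (\<Psi>k has_vector_derivative H 1 s) (at s within I)) \<and>
     (\<forall>t\<in>{2..k}. \<forall>s\<in>I.
        ((\<lambda>u. H (t - 1) u /\<^sub>R h (t - 1) (t - 1) u) has_vector_derivative H t s) (at s within I))"

definition F_matrix ::
  "nat \<Rightarrow> (nat \<Rightarrow> nat \<Rightarrow> real \<Rightarrow> real) \<Rightarrow> (nat \<Rightarrow> real \<Rightarrow> real^'q^'q) \<Rightarrow> real \<Rightarrow> real^'q^'q" where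
  "F_matrix k h H s = (\<Prod>l\<in>{1..<k}. h l l s) *\<^sub>R H k s"

text \<open>The derivative of the transformation \<open>c\<close> must not vanish at the points that may occur as
  non-fixed design points: at a point with \<open>c' x = 0\<close> (such as \<open>x = 0\<close> for \<open>c x = x ^ 3\<close>) every
  criterion is trivially stationary in that design point.\<close>

definition smooth_transformation :: "real set \<Rightarrow> ereal set \<Rightarrow> (real \<Rightarrow> real) \<Rightarrow> bool" where
  "smooth_transformation X Fix c \<longleftrightarrow>
     (strict_mono_on X c \<or> strict_antimono_on X c) \<and>
     (\<exists>c'. (\<forall>x\<in>X. (c has_real_derivative c' x) (at x within X)) \<and> continuous_on X c' \<and>
           (\<forall>x\<in>X. ereal x \<notin> Fix \<longrightarrow> c' x \<noteq> 0))"

text \<open>The endpoints of the design space corresponding to the endpoints \<open>A\<close> and \<open>B\<close> of the range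
  of \<open>c\<close>.\<close>

definition A_end :: "ereal \<Rightarrow> ereal \<Rightarrow> (real \<Rightarrow> real) \<Rightarrow> ereal" where
  "A_end L U c = (if strict_mono_on (design_space L U) c then L else U)"

definition B_end :: "ereal \<Rightarrow> ereal \<Rightarrow> (real \<Rightarrow> real) \<Rightarrow> ereal" where
  "B_end L U c = (if strict_mono_on (design_space L U) c then U else L)"

definition complete_class_hypothesis ::
  "ereal \<Rightarrow> ereal \<Rightarrow> (real \<Rightarrow> real^('p::finite + 'q::finite)^('p + 'q)) \<Rightarrow> nat \<Rightarrow> ereal set \<Rightarrow> bool" where
  "complete_class_hypothesis L U M m Fix \<longleftrightarrow>
     CARD('p + 'q) \<le> m \<and>
     (\<exists>P (C :: real \<Rightarrow> real^('p + 'q)^('p + 'q)) c k \<Psi> h H.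
        let X = design_space L U; I = c ` X; F = F_matrix k h H in
          invertible P \<and>
          smooth_transformation X Fix c \<and>
          (\<forall>s\<in>I. transpose (C s) = C s) \<and>
          (\<forall>x\<in>X. M x = P ** C (c x) ** transpose P) \<and>
          maximal_indep_entries I C k \<Psi> \<and>
          derivative_chain I k \<Psi> (\<lambda>s. lower_block (C s)) h H \<and>
          (k = 2 * m - 1 \<and> (\<forall>s\<in>I. - F s \<in> PD) \<and> Fix = {A_end L U c} \<or>
           k = 2 * m - 1 \<and> (\<forall>s\<in>I. F s \<in> PD) \<and> Fix = {B_end L U c} \<or>
           k = 2 * m \<and> (\<forall>s\<in>I. - F s \<in> PD) \<and> Fix = {} \<or>
           k = 2 * m - 2 \<and> (\<forall>s\<in>I. F s \<in> PD) \<and> Fix = {L, U}))"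

text \<open>The class \<open>\<Xi>\<close>, with \<open>Fix\<close> its set of fixed design points.\<close>

definition design_class :: "real set \<Rightarrow> nat \<Rightarrow> ereal set \<Rightarrow> design set" where
  "design_class X m Fix =
     {\<xi> \<in> designs X. card (fst ` set \<xi>) \<le> m \<and> Fix \<subseteq> ereal ` fst ` set \<xi>}"


section \<open>Objective function and critical points\<close>

definition nonfixed :: "ereal \<Rightarrow> ereal \<Rightarrow> nat \<Rightarrow> ereal set \<Rightarrow> nat set" where
  "nonfixed L U m Fix = {i\<in>{1..m}. \<not> (i = 1 \<and> L \<in> Fix) \<and> \<not> (i = m \<and> U \<in> Fix)}"

text \<open>The vector \<open>Z\<close> lives in \<open>real^'z\<close>. Its coordinates are labelled by \<open>e\<close>: \<open>e (Inl i)\<close> is the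
  coordinate of the non-fixed design point \<open>x\<^sub>i\<close> and \<open>e (Inr i)\<close> the one of the weight \<open>\<omega>\<^sub>i\<close>, \<open>2 \<le> i \<le> m\<close>.\<close>

definition labelling :: "ereal \<Rightarrow> ereal \<Rightarrow> nat \<Rightarrow> ereal set \<Rightarrow> (nat + nat \<Rightarrow> 'z) \<Rightarrow> bool" where
  "labelling L U m Fix e \<longleftrightarrow> bij_betw e (nonfixed L U m Fix <+> {2..m}) UNIV"

definition point_of ::
  "ereal \<Rightarrow> ereal \<Rightarrow> nat \<Rightarrow> ereal set \<Rightarrow> (nat + nat \<Rightarrow> 'z) \<Rightarrow> real^'z \<Rightarrow> nat \<Rightarrow> real" where
  "point_of L U m Fix e Z i =
     (if i = 1 \<and> L \<in> Fix then real_of_ereal L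
      else if i = m \<and> U \<in> Fix then real_of_ereal U
      else Z $ e (Inl i))"

definition weight_of :: "nat \<Rightarrow> (nat + nat \<Rightarrow> 'z) \<Rightarrow> real^'z \<Rightarrow> nat \<Rightarrow> real" where
  "weight_of m e Z i = (if i = 1 then 1 - (\<Sum>j=2..m. Z $ e (Inr j)) else Z $ e (Inr i))"

definition design_of ::
  "ereal \<Rightarrow> ereal \<Rightarrow> nat \<Rightarrow> ereal set \<Rightarrow> (nat + nat \<Rightarrow> 'z) \<Rightarrow> real^'z \<Rightarrow> design" where
  "design_of L U m Fix e Z =
     map (\<lambda>i. (point_of L U m Fix e Z i, weight_of m e Z i)) [1..<m + 1]"

text \<open>The vectors that represent designs of \<open>\<Xi>\<close>. If a fixed endpoint is infinite there are none.\<close>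

definition Z_domain ::
  "ereal \<Rightarrow> ereal \<Rightarrow> nat \<Rightarrow> ereal set \<Rightarrow> (nat + nat \<Rightarrow> 'z) \<Rightarrow> (real^'z) set" where
  "Z_domain L U m Fix e =
     {Z. strict_mono_on {1..m} (point_of L U m Fix e Z) \<and>
         design_of L U m Fix e Z \<in> design_class (design_space L U) m Fix}"

definition objective ::
  "ereal \<Rightarrow> ereal \<Rightarrow> (real \<Rightarrow> real^'n^'n) \<Rightarrow> (real^'n^'n \<Rightarrow> real) \<Rightarrow> nat \<Rightarrow> ereal set \<Rightarrow>
   (nat + nat \<Rightarrow> 'z) \<Rightarrow> real^'z \<Rightarrow> real" where
  "objective L U M \<Phi> m Fix e Z = \<Phi> (info_matrix M (design_of L U m Fix e Z))"

text \<open>The derivative is taken within the domain of the objective function, i.e. it is one-sided in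
  a non-fixed design point lying at an endpoint of the design space. Membership in the domain
  includes that all design points belong to the design space.\<close>

definition feasible_critical_point ::
  "ereal \<Rightarrow> ereal \<Rightarrow> (real \<Rightarrow> real^'n^'n) \<Rightarrow> (real^'n^'n \<Rightarrow> real) \<Rightarrow> nat \<Rightarrow> ereal set \<Rightarrow>
   (nat + nat \<Rightarrow> 'z::finite) \<Rightarrow> real^'z \<Rightarrow> bool" where
  "feasible_critical_point L U M \<Phi> m Fix e Z \<longleftrightarrow>
     Z \<in> Z_domain L U m Fix e \<and>
     (objective L U M \<Phi> m Fix e has_derivative (\<lambda>_. 0)) (at Z within Z_domain L U m Fix e) \<and>
     (\<forall>i\<in>{2..m}. 0 < Z $ e (Inr i)) \<and> (\<Sum>i=2..m. Z $ e (Inr i)) < 1"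

end

theory Submission
  imports Defs
begin

text \<open>
  Suppose that some design \<open>\<zeta>\<close> is strictly better than the design \<open>\<xi>\<close> of the critical point \<open>Z\<close>. By
  concavity the criterion grows at a positive rate along the segment from \<open>\<xi>\<close> to \<open>\<zeta>\<close>. The proof
  shadows this segment by a straight line \<open>Z + t D\<close> in parameter space, along which the criterion
  must grow at a positive rate as well, whereas its derivative at the critical point \<open>Z\<close> is zero.

  The link between the segment and the line is the moment vector of a design, the mean of
  \<open>(\<Psi>\<^sub>1, \<dots>, \<Psi>\<^sub>k\<^sub>-\<^sub>1)\<close>. It determines the first columns of the information matrix (up to the linear map
  given by \<open>P\<close>), and the line is chosen so that its moments move, to first order, like those of the
  segment. Two facts are needed.

  \<^item> \<open>domination\<close>: among all designs with given moments, one of the form described by a vector \<open>Z\<close>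
    has the largest information matrix. For each \<open>q\<close> the function \<open>q \<bullet> C(s) q\<close> is a quadratic form in
    the lower block up to the span of \<open>1, \<Psi>\<^sub>1, \<dots>, \<Psi>\<^sub>k\<^sub>-\<^sub>1\<close>. It is interpolated by that span with double
    nodes at the non-fixed design points and simple nodes at the fixed ones, and the sign of \<open>F\<close>
    makes the interpolant a majorant (\<open>top_majorant\<close>). Integration gives the inequality.
  \<^item> \<open>moment_direction\<close>: the derivative of the moments with respect to \<open>Z\<close> is invertible, so every
    direction of moments towards another design is the image of a direction \<open>D\<close>, and \<open>D\<close> points
    inwards at design points on the boundary of the design space.

  Both facts rest on one zero-counting principle of Rolle type. A list of points at which a function
  weakly alternates in sign yields a list, shorter by one, at which its derivative does so. Passing
  through the chain \<open>f\<^bsub>l,t\<^esub>\<close>, whose diagonal entries have constant sign, a function with too many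
  zeros or sign changes contradicts the definiteness of \<open>F\<close> (\<open>alternation_top_sign\<close>) or has zero
  coefficients (\<open>alternation_imp_zero\<close>).

  The line agrees with the segment to first order only. The error is absorbed by first
  mixing into \<open>\<zeta>\<close> a small amount of a design whose moments are interior to the set of all moments:
  that part can be adjusted so that the moments agree exactly, at the cost of only a part of
  the gain (\<open>critical_point_optimal\<close>).
\<close>

section \<open>Sign alternation and derivatives\<close>

fun weakly_alternates :: "real \<Rightarrow> (real \<Rightarrow> real) \<Rightarrow> real list \<Rightarrow> bool" where
  "weakly_alternates \<sigma> f [] \<longleftrightarrow> True"
| "weakly_alternates \<sigma> f (x # xs) \<longleftrightarrow> 0 \<le> \<sigma> * f x \<and> weakly_alternates (- \<sigma>) f xs"

lemma weakly_alternates_append: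
  "weakly_alternates \<sigma> f (xs @ ys) \<longleftrightarrow>
     weakly_alternates \<sigma> f xs \<and> weakly_alternates ((- 1) ^ length xs * \<sigma>) f ys"
  by (induction xs arbitrary: \<sigma>) auto

lemma weakly_alternates_cong:
  assumes "\<And>x. x \<in> set xs \<Longrightarrow> f x = g x"
  shows "weakly_alternates \<sigma> f xs \<longleftrightarrow> weakly_alternates \<sigma> g xs"
  using assms by (induction xs arbitrary: \<sigma>) auto

lemma weakly_alternates_divide:
  assumes "weakly_alternates \<sigma> f xs" and "\<And>x. x \<in> set xs \<Longrightarrow> sgn (w x) = \<tau>"
  shows "weakly_alternates (\<sigma> * \<tau>) (\<lambda>x. f x / w x) xs"
  using assms
proof (induction xs arbitrary: \<sigma>)
  case (Cons x xs)
  have "weakly_alternates (- \<sigma> * \<tau>) (\<lambda>x. f x / w x) xs"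
    using Cons.IH[of "- \<sigma>"] Cons.prems by simp
  moreover have "\<tau> = sgn (w x)"
    using Cons.prems(2)[of x] by simp
  then have "\<sigma> * \<tau> * (f x / w x) = (\<sigma> * f x) * \<bar>inverse (w x)\<bar>"
    by (simp add: sgn_real_def divide_inverse)
  then have "0 \<le> \<sigma> * \<tau> * (f x / w x)"
    using Cons.prems(1) by simp
  ultimately show ?case
    by simp
qed simp

lemma mean_value_within:
  fixes f :: "real \<Rightarrow> real"
  assumes "is_interval I" "a \<in> I" "b \<in> I" "a < b"
    and "\<And>x. x \<in> I \<Longrightarrow> (f has_real_derivative f' x) (at x within I)"
  obtains x where "a < x" "x < b" "x \<in> I" "f b - f a = f' x * (b - a)"
proof -
  have sub: "{a..b} \<subseteq> I"
    using mem_is_interval_1_I[OF assms(1-3)] by auto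
  have "\<exists>x\<in>{a<..<b}. f b - f a = f' x * (b - a)"
  proof (rule mvt_simple[OF \<open>a < b\<close>])
    fix x assume "a \<le> x" "x \<le> b"
    then have "(f has_real_derivative f' x) (at x within I)"
      using assms(5) sub by auto
    then have "(f has_real_derivative f' x) (at x within {a..b})"
      by (rule has_field_derivative_subset[OF _ sub])
    then show "(f has_derivative (*) (f' x)) (at x within {a..b})"
      by (simp add: has_field_derivative_def)
  qed
  then obtain x where "a < x" "x < b" "f b - f a = f' x * (b - a)"
    by auto
  then show thesis
    using sub by (intro that[of x]) auto
qed

text \<open>The mean value theorem on each gap: a weak rise or fall between neighbours forces the
  corresponding weak sign of the derivative strictly inside the gap. Weak signs suffice, so zeros
  may be counted with either sign.\<close>

lemma weakly_alternates_derivative: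
  fixes f :: "real \<Rightarrow> real"
  assumes "is_interval I"
    and deriv: "\<And>x. x \<in> I \<Longrightarrow> (f has_real_derivative f' x) (at x within I)"
    and "weakly_alternates \<sigma> f (x # xs)" "sorted_wrt (<) (x # xs)" "set (x # xs) \<subseteq> I"
  shows "\<exists>ys. length ys = length xs \<and> sorted_wrt (<) (x # ys) \<and> set ys \<subseteq> I \<and>
           weakly_alternates (- \<sigma>) f' ys"
  using assms(3-)
proof (induction xs arbitrary: x \<sigma>)
  case (Cons b xs)
  obtain y where y: "x < y" "y < b" "y \<in> I" "f b - f x = f' y * (b - x)"
    using mean_value_within[OF assms(1), of x b f f'] Cons.prems deriv by auto
  have "- \<sigma> * f' y * (b - x) = - \<sigma> * (f b - f x)"
    by (simp add: y(4))
  also have "\<dots> \<ge> 0"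
    using Cons.prems(1) by (simp add: algebra_simps)
  finally have "0 \<le> - \<sigma> * f' y"
    using y(1,2) by (simp add: mult_le_0_iff zero_le_mult_iff)
  moreover obtain ys where "length ys = length xs" "sorted_wrt (<) (b # ys)" "set ys \<subseteq> I"
    "weakly_alternates (- (- \<sigma>)) f' ys"
    using Cons.IH[of "- \<sigma>" b] Cons.prems by auto
  ultimately show ?case
    using y by (intro exI[of _ "y # ys"]) (auto intro: less_trans)
qed simp

text \<open>Darboux: otherwise the minimum over \<open>[a, b]\<close> is interior and the derivative vanishes there. The
  derivative itself is not assumed continuous.\<close>

lemma nonzero_derivative_not_neg_pos:
  fixes f :: "real \<Rightarrow> real"
  assumes "is_interval I"
    and deriv: "\<And>x. x \<in> I \<Longrightarrow> (f has_real_derivative f' x) (at x within I)"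
    and nz: "\<And>x. x \<in> I \<Longrightarrow> f' x \<noteq> 0"
    and "a \<in> I" "b \<in> I" "a < b" "f' a < 0" "0 < f' b"
  shows False
proof -
  have sub: "{a..b} \<subseteq> I"
    using mem_is_interval_1_I[OF assms(1,4,5)] by auto
  have deriv': "(f has_real_derivative f' x) (at x within {a..b})" if "x \<in> {a..b}" for x
    by (rule has_field_derivative_subset[OF deriv sub]) (use that sub in auto)
  have "continuous_on {a..b} f"
    using deriv' by (rule DERIV_continuous_on)
  then obtain x where x: "x \<in> {a..b}" and min: "\<And>y. y \<in> {a..b} \<Longrightarrow> f x \<le> f y"
    using continuous_attains_inf[of "{a..b}" f] \<open>a < b\<close> by auto
  have "x \<noteq> a"
  proof
    assume "x = a"
    obtain d where "d > 0" "\<And>h. 0 < h \<Longrightarrow> a + h \<in> {a..b} \<Longrightarrow> h < d \<Longrightarrow> f (a + h) < f a"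
      using has_real_derivative_neg_dec_right[OF deriv'[of a]] assms(6,7) by auto
    moreover define h where "h = min (d / 2) (b - a)"
    ultimately have "0 < h" "h < d" "a + h \<in> {a..b}" "f (a + h) < f a"
      using \<open>a < b\<close> by (auto simp: min_def)
    with min[of "a + h"] \<open>x = a\<close> show False by simp
  qed
  moreover have "x \<noteq> b"
  proof
    assume "x = b"
    obtain d where "d > 0" "\<And>h. 0 < h \<Longrightarrow> b - h \<in> {a..b} \<Longrightarrow> h < d \<Longrightarrow> f (b - h) < f b"
      using has_real_derivative_pos_inc_left[OF deriv'[of b]] assms(6,8) by auto
    moreover define h where "h = min (d / 2) (b - a)"
    ultimately have "0 < h" "h < d" "b - h \<in> {a..b}" "f (b - h) < f b"
      using \<open>a < b\<close> by (auto simp: min_def)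
    with min[of "b - h"] \<open>x = b\<close> show False by simp
  qed
  ultimately have x': "a < x" "x < b"
    using x by auto
  have "at x within {a..b} = at x"
    using x' by (simp add: at_within_Icc_at)
  with deriv'[OF x] have "DERIV f x :> f' x"
    by simp
  moreover have "\<forall>y. \<bar>x - y\<bar> < min (x - a) (b - x) \<longrightarrow> f x \<le> f y"
    by (auto intro!: min)
  ultimately have "f' x = 0"
    using DERIV_local_min[of f "f' x" x "min (x - a) (b - x)"] x' by auto
  with nz x sub show False by auto
qed

lemma nonzero_derivative_const_sgn:
  fixes f :: "real \<Rightarrow> real"
  assumes "is_interval I"
    and deriv: "\<And>x. x \<in> I \<Longrightarrow> (f has_real_derivative f' x) (at x within I)"
    and nz: "\<And>x. x \<in> I \<Longrightarrow> f' x \<noteq> 0"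
    and "a \<in> I" "b \<in> I"
  shows "sgn (f' a) = sgn (f' b)"
proof -
  have aux: "\<not> (f' a < 0 \<and> 0 < f' b)" if "a \<in> I" "b \<in> I" for a b
  proof (cases a b rule: linorder_cases)
    case less
    then show ?thesis
      using nonzero_derivative_not_neg_pos[OF assms(1) deriv nz that less] by auto
  next
    case greater
    have "\<And>x. x \<in> I \<Longrightarrow> ((\<lambda>x. - f x) has_real_derivative - f' x) (at x within I)"
      by (intro DERIV_minus deriv)
    from nonzero_derivative_not_neg_pos[OF assms(1) this _ that(2,1) greater] nz show ?thesis
      by auto
  qed simp
  show ?thesis
    using aux[OF assms(4,5)] aux[OF assms(5,4)] nz[OF assms(4)] nz[OF assms(5)]
    by (auto simp: sgn_real_def)
qed

text \<open>Iterating the Rolle step through divisions by functions \<open>w t\<close> of constant sign \<open>\<tau> t\<close>: each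
  differentiation costs one point and flips the leading sign.\<close>

lemma weakly_alternates_chain:
  fixes g w :: "nat \<Rightarrow> real \<Rightarrow> real"
  assumes "is_interval I" "1 \<le> n"
    and deriv: "\<And>t s. t \<in> {2..n} \<Longrightarrow> s \<in> I \<Longrightarrow>
      ((\<lambda>u. g (t - 1) u / w (t - 1) u) has_real_derivative g t s) (at s within I)"
    and sgn: "\<And>t s. t \<in> {1..<n} \<Longrightarrow> s \<in> I \<Longrightarrow> sgn (w t s) = \<tau> t"
    and "weakly_alternates \<sigma> (g 1) xs" "sorted_wrt (<) xs" "set xs \<subseteq> I" "n \<le> length xs"
  shows "\<exists>ys. length ys = length xs - (n - 1) \<and> sorted_wrt (<) ys \<and> set ys \<subseteq> I \<and>
           weakly_alternates ((- 1) ^ (n - 1) * \<sigma> * (\<Prod>t\<in>{1..<n}. \<tau> t)) (g n) ys"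
  using assms(2-)
proof (induction n rule: nat_induct_at_least)
  case base
  then show ?case by auto
next
  case (Suc n)
  let ?\<sigma> = "(- 1) ^ (n - 1) * \<sigma> * (\<Prod>t\<in>{1..<n}. \<tau> t)"
  have "\<exists>ys. length ys = length xs - (n - 1) \<and> sorted_wrt (<) ys \<and> set ys \<subseteq> I \<and>
          weakly_alternates ?\<sigma> (g n) ys"
    by (rule Suc.IH) (use Suc.prems in simp_all)
  then obtain ys where ys: "length ys = length xs - (n - 1)" "sorted_wrt (<) ys" "set ys \<subseteq> I"
    "weakly_alternates ?\<sigma> (g n) ys" by blast
  have "weakly_alternates (?\<sigma> * \<tau> n) (\<lambda>u. g n u / w n u) ys"
    by (rule weakly_alternates_divide[OF ys(4)]) (use Suc.prems(2)[of n] Suc.hyps ys(3) in auto)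
  moreover obtain y ys' where y: "ys = y # ys'"
    using ys(1) Suc.prems(6) Suc.hyps by (cases ys) simp_all
  moreover have "((\<lambda>u. g n u / w n u) has_real_derivative g (Suc n) s) (at s within I)" if "s \<in> I" for s
    using Suc.prems(1)[of "Suc n" s] Suc.hyps that by simp
  ultimately obtain zs where zs: "length zs = length ys'" "sorted_wrt (<) (y # zs)" "set zs \<subseteq> I"
      "weakly_alternates (- (?\<sigma> * \<tau> n)) (g (Suc n)) zs"
    using weakly_alternates_derivative[OF assms(1), of "\<lambda>u. g n u / w n u" "g (Suc n)" "?\<sigma> * \<tau> n" y ys']
      ys(2,3) by blast
  have "(- 1 :: real) ^ n = - ((- 1) ^ (n - 1))"
    using Suc.hyps by (cases n) simp_all
  then have "- (?\<sigma> * \<tau> n) = (- 1) ^ (Suc n - 1) * \<sigma> * (\<Prod>t\<in>{1..<Suc n}. \<tau> t)"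
    using Suc.hyps by (simp add: prod.atLeastLessThan_Suc)
  moreover have "length zs = length xs - (Suc n - 1)"
    using zs(1) ys(1) y Suc.hyps Suc.prems(6) by simp
  ultimately show ?case
    using zs by (metis sorted_wrt.simps(2))
qed

section \<open>Zeros of a function and the signs of its derivative\<close>

text \<open>Starting from a point \<open>p\<close> where \<open>u\<close> has the weak sign \<open>\<kappa>\<close>, every later zero of \<open>u\<close> contributes two
  points for the derivative: a point of the gap before it and the zero itself. The function \<open>d\<close>
  stands for the derivative, with its values at the zeros left free; this allows zeros that are
  only simple to be handled as if they were double and to be discarded later.\<close>

lemma alternation_after_zeros:
  fixes u d :: "real \<Rightarrow> real"
  assumes "is_interval I"
    and deriv: "\<And>s. s \<in> I \<Longrightarrow> (u has_real_derivative u' s) (at s within I)"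
    and "p \<in> I" "0 \<le> \<kappa> * u p" "sorted_wrt (<) (p # zs)" "set zs \<subseteq> I"
    and "\<And>z. z \<in> set zs \<Longrightarrow> u z = 0 \<and> 0 \<le> \<kappa> * d z"
    and "\<And>s. s \<in> I \<Longrightarrow> p < s \<Longrightarrow> s \<notin> set zs \<Longrightarrow> d s = u' s"
  shows "\<exists>xs. length xs = 2 * length zs \<and> sorted_wrt (<) (p # xs) \<and> set zs \<subseteq> set xs \<and>
           set xs \<subseteq> I \<and> weakly_alternates (- \<kappa>) d xs"
  using assms(3-)
proof (induction zs arbitrary: p)
  case Nil
  show ?case by (intro exI[of _ "[]"]) simp
next
  case (Cons z zs)
  have z: "z \<in> I" "p < z" "u z = 0" "0 \<le> \<kappa> * d z"
    using Cons.prems(3,4,5) by simp_all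
  have zs: "sorted_wrt (<) (z # zs)" "set zs \<subseteq> I"
    using Cons.prems(3,4) by simp_all
  obtain y where y: "p < y" "y < z" "y \<in> I" "u z - u p = u' y * (z - p)"
    using mean_value_within[OF assms(1) Cons.prems(1) z(1,2) deriv] by metis
  have "- \<kappa> * u' y * (z - p) = - \<kappa> * (u z - u p)"
    by (simp add: y(4))
  also have "\<dots> \<ge> 0"
    using z(3) Cons.prems(2) by simp
  finally have "0 \<le> - \<kappa> * u' y"
    using z(2) by (simp add: mult_le_0_iff zero_le_mult_iff)
  moreover have "y \<notin> set (z # zs)"
    using zs(1) y(2) by force
  then have "d y = u' y"
    using Cons.prems(6)[of y] y by blast
  ultimately have dy: "0 \<le> - \<kappa> * d y" by simp
  have "\<exists>xs. length xs = 2 * length zs \<and> sorted_wrt (<) (z # xs) \<and> set zs \<subseteq> set xs \<and>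
           set xs \<subseteq> I \<and> weakly_alternates (- \<kappa>) d xs"
  proof (rule Cons.IH[OF z(1) _ zs])
    show "d s = u' s" if "s \<in> I" "z < s" "s \<notin> set zs" for s
      using Cons.prems(6)[of s] that z(2) by simp
  qed (use z Cons.prems(5) in simp_all)
  then obtain xs where xs: "length xs = 2 * length zs" "sorted_wrt (<) (z # xs)" "set zs \<subseteq> set xs"
      "set xs \<subseteq> I" "weakly_alternates (- \<kappa>) d xs"
    by blast
  have "sorted_wrt (<) (p # y # z # xs)"
    using xs(2) y z by (auto intro: less_trans)
  then show ?case
    using xs y z dy by (intro exI[of _ "y # z # xs"]) auto
qed

lemma alternation_before_zeros:
  fixes u d :: "real \<Rightarrow> real"
  assumes "is_interval I"
    and deriv: "\<And>s. s \<in> I \<Longrightarrow> (u has_real_derivative u' s) (at s within I)"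
    and "p \<in> I" "0 \<le> \<kappa> * u p" "sorted_wrt (<) (zs @ [p])" "set zs \<subseteq> I"
    and "\<And>z. z \<in> set zs \<Longrightarrow> u z = 0 \<and> 0 \<le> - \<kappa> * d z"
    and "\<And>s. s \<in> I \<Longrightarrow> s < p \<Longrightarrow> s \<notin> set zs \<Longrightarrow> d s = u' s"
  shows "\<exists>xs. length xs = 2 * length zs \<and> sorted_wrt (<) (xs @ [p]) \<and> set zs \<subseteq> set xs \<and>
           set xs \<subseteq> I \<and> weakly_alternates (- \<kappa>) d xs"
  using assms(3-)
proof (induction zs arbitrary: p rule: rev_induct)
  case Nil
  show ?case by (intro exI[of _ "[]"]) simp
next
  case (snoc z zs)
  have z: "z \<in> I" "z < p" "u z = 0" "0 \<le> - \<kappa> * d z"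
    using snoc.prems(3,4,5) by (simp_all add: sorted_wrt_append)
  have zs: "sorted_wrt (<) (zs @ [z])" "set zs \<subseteq> I"
    using snoc.prems(3,4) by (simp_all add: sorted_wrt_append)
  obtain y where y: "z < y" "y < p" "y \<in> I" "u p - u z = u' y * (p - z)"
    using mean_value_within[OF assms(1) z(1) snoc.prems(1) z(2) deriv] by metis
  have "\<kappa> * u' y * (p - z) = \<kappa> * (u p - u z)"
    by (simp add: y(4))
  also have "\<dots> \<ge> 0"
    using z(3) snoc.prems(2) by simp
  finally have "0 \<le> \<kappa> * u' y"
    using z(2) by (simp add: zero_le_mult_iff)
  moreover have "y \<notin> set (zs @ [z])"
    using zs(1) y(1) by (force simp: sorted_wrt_append)
  then have "d y = u' y"
    using snoc.prems(6)[of y] y by blast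
  ultimately have dy: "0 \<le> \<kappa> * d y" by simp
  have "\<exists>xs. length xs = 2 * length zs \<and> sorted_wrt (<) (xs @ [z]) \<and> set zs \<subseteq> set xs \<and>
           set xs \<subseteq> I \<and> weakly_alternates (- \<kappa>) d xs"
  proof (rule snoc.IH[OF z(1) _ zs])
    show "d s = u' s" if "s \<in> I" "s < z" "s \<notin> set zs" for s
      using snoc.prems(6)[of s] that z(2) by simp
  qed (use z snoc.prems(5) in simp_all)
  then obtain xs where xs: "length xs = 2 * length zs" "sorted_wrt (<) (xs @ [z])" "set zs \<subseteq> set xs"
      "set xs \<subseteq> I" "weakly_alternates (- \<kappa>) d xs"
    by blast
  have "sorted_wrt (<) ((xs @ [z, y]) @ [p])"
    using xs(2) y z by (auto simp: sorted_wrt_append intro: less_trans)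
  then show ?case
    using xs y z dy by (intro exI[of _ "xs @ [z, y]"]) (auto simp: weakly_alternates_append)
qed

text \<open>The endpoints of \<open>I\<close> that every design of the class contains. If an endpoint is fixed but does
  not belong to \<open>I\<close>, no design qualifies.\<close>

definition fixed_ends :: "real set \<Rightarrow> bool \<Rightarrow> bool \<Rightarrow> real set" where
  "fixed_ends I lo hi = {s\<in>I. lo \<and> (\<forall>t\<in>I. s \<le> t) \<or> hi \<and> (\<forall>t\<in>I. t \<le> s)}"

text \<open>A function with a zero at each point of \<open>S\<close>, double except at fixed endpoints, and a further
  point \<open>p\<close> of sign \<open>\<kappa>\<close>. The zeros on both sides of \<open>p\<close> and the gaps next to \<open>p\<close> give \<open>2 * card S\<close> points
  at which the derivative alternates; each fixed endpoint is the first or last of them and has to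
  be dropped, since nothing is known about the derivative there. At a non-fixed endpoint of \<open>I\<close> the
  derivative need not vanish as long as it has the sign that fits the alternation.\<close>

lemma alternation_from_zeros:
  fixes u :: "real \<Rightarrow> real"
  assumes "is_interval I"
    and deriv: "\<And>s. s \<in> I \<Longrightarrow> (u has_real_derivative u' s) (at s within I)"
    and S: "finite S" "S \<subseteq> I"
    and lo: "lo \<Longrightarrow> \<exists>s\<in>S. \<forall>t\<in>I. s \<le> t" and hi: "hi \<Longrightarrow> \<exists>s\<in>S. \<forall>t\<in>I. t \<le> s"
    and zero: "\<And>s. s \<in> S \<Longrightarrow> u s = 0"
    and crit: "\<And>s. s \<in> S \<Longrightarrow> s \<notin> fixed_ends I lo hi \<Longrightarrow>
      u' s = 0 \<or> (\<forall>t\<in>I. s \<le> t) \<and> 0 \<le> - \<kappa> * u' s \<or> (\<forall>t\<in>I. t \<le> s) \<and> 0 \<le> \<kappa> * u' s"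
    and p: "p \<in> I" "p \<notin> S" "0 \<le> \<kappa> * u p"
  shows "\<exists>xs. length xs = 2 * card S - of_bool lo - of_bool hi \<and> sorted_wrt (<) xs \<and> set xs \<subseteq> I \<and>
           weakly_alternates (if lo then \<kappa> else - \<kappa>) u' xs"
proof -
  \<comment> \<open>At a fixed endpoint the value \<open>0\<close> is fictitious; the point is removed from the list below.\<close>
  define d where "d s = (if s \<in> S \<inter> fixed_ends I lo hi then 0 else u' s)" for s
  have crit': "d s = 0 \<or> (\<forall>t\<in>I. s \<le> t) \<and> 0 \<le> - \<kappa> * d s \<or> (\<forall>t\<in>I. t \<le> s) \<and> 0 \<le> \<kappa> * d s"
    if "s \<in> S" for s
    using crit[of s] that by (auto simp: d_def)
  define zl where "zl = sorted_list_of_set {s\<in>S. s < p}"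
  define zr where "zr = sorted_list_of_set {s\<in>S. p < s}"
  have zl: "set zl = {s\<in>S. s < p}" "sorted_wrt (<) zl" "length zl = card {s\<in>S. s < p}"
    using S(1) by (simp_all add: zl_def)
  have zr: "set zr = {s\<in>S. p < s}" "sorted_wrt (<) zr" "length zr = card {s\<in>S. p < s}"
    using S(1) by (simp_all add: zr_def)
  have "card S = card ({s\<in>S. s < p} \<union> {s\<in>S. p < s})"
    using p(2) by (intro arg_cong[where f = card]) (auto simp: not_less_iff_gr_or_eq)
  also have "\<dots> = length zl + length zr"
    using S(1) zl(3) zr(3) by (subst card_Un_disjoint) auto
  finally have card: "card S = length zl + length zr" .
  have "\<exists>xs. length xs = 2 * length zl \<and> sorted_wrt (<) (xs @ [p]) \<and> set zl \<subseteq> set xs \<and>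
           set xs \<subseteq> I \<and> weakly_alternates (- \<kappa>) d xs"
  proof (rule alternation_before_zeros[OF assms(1) deriv p(1,3)])
    show "u z = 0 \<and> 0 \<le> - \<kappa> * d z" if "z \<in> set zl" for z
      using zero[of z] crit'[of z] that p(1) zl(1) by fastforce
    show "d s = u' s" if "s \<in> I" "s < p" "s \<notin> set zl" for s
      using that zl(1) by (auto simp: d_def)
  qed (use zl S(2) in \<open>auto simp: sorted_wrt_append\<close>)
  then obtain xl where xl: "length xl = 2 * length zl" "sorted_wrt (<) (xl @ [p])"
      "set zl \<subseteq> set xl" "set xl \<subseteq> I" "weakly_alternates (- \<kappa>) d xl"
    by blast
  have "\<exists>xs. length xs = 2 * length zr \<and> sorted_wrt (<) (p # xs) \<and> set zr \<subseteq> set xs \<and>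
           set xs \<subseteq> I \<and> weakly_alternates (- \<kappa>) d xs"
  proof (rule alternation_after_zeros[OF assms(1) deriv p(1,3)])
    show "u z = 0 \<and> 0 \<le> \<kappa> * d z" if "z \<in> set zr" for z
      using zero[of z] crit'[of z] that p(1) zr(1) by fastforce
    show "d s = u' s" if "s \<in> I" "p < s" "s \<notin> set zr" for s
      using that zr(1) by (auto simp: d_def)
  qed (use zr S(2) in auto)
  then obtain xr where xr: "length xr = 2 * length zr" "sorted_wrt (<) (p # xr)"
      "set zr \<subseteq> set xr" "set xr \<subseteq> I" "weakly_alternates (- \<kappa>) d xr"
    by blast
  define xs where "xs = xl @ xr"
  have xs: "length xs = 2 * card S" "sorted_wrt (<) xs" "S \<subseteq> set xs" "set xs \<subseteq> I"
      "weakly_alternates (- \<kappa>) d xs"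
  proof -
    show "sorted_wrt (<) xs"
      using xl(2) xr(2) by (auto simp: xs_def sorted_wrt_append intro: less_trans)
    show "S \<subseteq> set xs"
    proof
      fix s assume "s \<in> S"
      then show "s \<in> set xs"
        using p(2) xl(3) xr(3) zl(1) zr(1) by (cases s p rule: linorder_cases) (auto simp: xs_def)
    qed
    show "weakly_alternates (- \<kappa>) d xs"
      using xl(1,5) xr(5) by (simp add: xs_def weakly_alternates_append)
  qed (use xl xr card in \<open>simp_all add: xs_def\<close>)
  obtain ys where ys: "length ys = length xs - of_bool lo" "sorted_wrt (<) ys" "set ys \<subseteq> set xs"
      "weakly_alternates (if lo then \<kappa> else - \<kappa>) d ys"
      "lo \<Longrightarrow> s \<in> set ys \<Longrightarrow> \<not> (\<forall>t\<in>I. s \<le> t)" for s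
  proof (cases lo)
    case True
    then obtain a where a: "a \<in> S" "\<forall>t\<in>I. a \<le> t"
      using lo by blast
    with xs(3) obtain x xs' where x: "xs = x # xs'"
      by (cases xs) auto
    have "x \<in> I" "a \<in> set xs"
      using x xs(3,4) a(1) by auto
    then have "x = a"
      using a(2) xs(2) x by (metis leD set_ConsD sorted_wrt.simps(2))
    moreover have "\<not> (\<forall>t\<in>I. s \<le> t)" if "s \<in> set xs'" for s
      using xs(2) x that \<open>x \<in> I\<close> by force
    ultimately show thesis
      using that[of xs'] True x xs(2,5) a(2) by auto
  next
    case False
    then show thesis using that[of xs] xs by simp
  qed
  obtain zs where zs: "length zs = length ys - of_bool hi" "sorted_wrt (<) zs" "set zs \<subseteq> set ys"
      "weakly_alternates (if lo then \<kappa> else - \<kappa>) d zs"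
      "hi \<Longrightarrow> s \<in> set zs \<Longrightarrow> \<not> (\<forall>t\<in>I. t \<le> s)" for s
  proof (cases "hi \<and> ys \<noteq> []")
    case True
    then obtain b where b: "b \<in> S" "\<forall>t\<in>I. t \<le> b"
      using hi by blast
    obtain x ys' where x: "ys = ys' @ [x]"
      using True by (metis rev_exhaust)
    have "x \<in> I"
      using x xs(4) ys(3) by auto
    moreover have "\<not> (\<forall>t\<in>I. t \<le> s)" if "s \<in> set ys'" for s
      using ys(2) x that \<open>x \<in> I\<close> by (force simp: sorted_wrt_append)
    ultimately show thesis
      using that[of ys'] True x ys(2,4) by (auto simp: sorted_wrt_append weakly_alternates_append)
  next
    case False
    then show thesis using that[of ys] ys by auto
  qed
  have "weakly_alternates (if lo then \<kappa> else - \<kappa>) u' zs"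
  proof (subst weakly_alternates_cong[of zs _ d])
    show "u' s = d s" if "s \<in> set zs" for s
      using that zs(3,5) ys(5) by (auto simp: d_def fixed_ends_def)
  qed (fact zs(4))
  then show ?thesis
    using zs(1-3) ys(1,3) xs(1,4) by (intro exI[of _ zs]) auto
qed

section \<open>Chebyshev systems given by a derivative chain\<close>

lemma sgn_prod:
  fixes f :: "'a \<Rightarrow> real"
  shows "sgn (\<Prod>i\<in>A. f i) = (\<Prod>i\<in>A. sgn (f i))"
  by (induction A rule: infinite_finite_induct) (simp_all add: sgn_mult)

text \<open>The scalar part of the derivative chain on an interval \<open>I\<close>. The flags \<open>lo\<close> and \<open>hi\<close> tell whether
  the least and the greatest point of \<open>I\<close> are fixed design points; with them the four cases of the
  complete class hypothesis become the single relation between \<open>k\<close> and \<open>m\<close>, and \<open>F > 0\<close> is required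
  exactly if \<open>hi\<close> holds.\<close>

locale chebyshev_chain =
  fixes I :: "real set" and k :: nat and \<Psi> :: "nat \<Rightarrow> real \<Rightarrow> real"
    and h :: "nat \<Rightarrow> nat \<Rightarrow> real \<Rightarrow> real" and lo hi :: bool and m :: nat
  assumes interval: "is_interval I"
    and infinite: "infinite I"
    and deriv_first: "\<And>l s. l \<in> {1..<k} \<Longrightarrow> s \<in> I \<Longrightarrow> (\<Psi> l has_real_derivative h l 1 s) (at s within I)"
    and deriv_next: "\<And>l t s. l \<in> {1..<k} \<Longrightarrow> t \<in> {2..l} \<Longrightarrow> s \<in> I \<Longrightarrow>
      ((\<lambda>u. h l (t - 1) u / h (t - 1) (t - 1) u) has_real_derivative h l t s) (at s within I)"
    and diagonal_nonzero: "\<And>l s. l \<in> {1..<k} \<Longrightarrow> s \<in> I \<Longrightarrow> h l l s \<noteq> 0"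
    and k_eq: "k = 2 * m - of_bool lo - of_bool hi" and k_pos: "1 \<le> k" and m_ge: "2 \<le> m"
begin

text \<open>The constant sign of the diagonal function \<open>f\<^bsub>l,l\<^esub>\<close>, read off at an arbitrary point of \<open>I\<close>. It is
  constant because \<open>f\<^bsub>l,l\<^esub>\<close> is a derivative without zeros.\<close>

definition diag_sgn :: "nat \<Rightarrow> real" where
  "diag_sgn l = sgn (h l l (SOME s. s \<in> I))"

lemma diag_sgn:
  assumes "l \<in> {1..<k}" "s \<in> I"
  shows "sgn (h l l s) = diag_sgn l"
proof -
  have "(SOME s. s \<in> I) \<in> I"
    using assms(2) by (rule someI)
  moreover obtain f where "\<And>s. s \<in> I \<Longrightarrow> (f has_real_derivative h l l s) (at s within I)"
  proof (cases "l = 1")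
    case True
    then show thesis using that[of "\<Psi> l"] deriv_first[OF assms(1)] by simp
  next
    case False
    then show thesis
      using that[of "\<lambda>u. h l (l - 1) u / h (l - 1) (l - 1) u"] deriv_next[OF assms(1), of l] assms(1) by auto
  qed
  ultimately show ?thesis
    unfolding diag_sgn_def
    using nonzero_derivative_const_sgn[OF interval] diagonal_nonzero[OF assms(1)] assms(2) by blast
qed

text \<open>The chain applied to \<open>y + b\<^sub>0 + b\<^sub>1 \<Psi>\<^sub>1 + \<dots>\<close>, where \<open>g t\<close> is the chain of \<open>y\<close>. Division by the
  diagonal function turns the lowest remaining coefficient into an additive constant, and the next
  derivative removes it.\<close>

lemma chain_alternation:
  fixes g :: "nat \<Rightarrow> real \<Rightarrow> real" and b :: "nat \<Rightarrow> real"
  assumes n: "1 \<le> n" "n \<le> k"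
    and g: "\<And>t s. t \<in> {2..n} \<Longrightarrow> s \<in> I \<Longrightarrow>
      ((\<lambda>u. g (t - 1) u / h (t - 1) (t - 1) u) has_real_derivative g t s) (at s within I)"
    and xs: "weakly_alternates \<sigma> (\<lambda>s. g 1 s + (\<Sum>l\<in>{1..<k}. b l * h l 1 s)) xs"
      "sorted_wrt (<) xs" "set xs \<subseteq> I" "n \<le> length xs"
  shows "\<exists>ys. length ys = length xs - (n - 1) \<and> sorted_wrt (<) ys \<and> set ys \<subseteq> I \<and>
           weakly_alternates ((- 1) ^ (n - 1) * \<sigma> * (\<Prod>t\<in>{1..<n}. diag_sgn t))
             (\<lambda>s. g n s + (\<Sum>l\<in>{n..<k}. b l * h l n s)) ys"
proof (rule weakly_alternates_chain[where w = "\<lambda>t. h t t" and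
      g = "\<lambda>n s. g n s + (\<Sum>l\<in>{n..<k}. b l * h l n s)" and xs = xs and n = n and \<sigma> = \<sigma>])
  show "is_interval I" "1 \<le> n"
    by (fact interval n(1))+
next
  fix t s assume t: "t \<in> {2..n}" and s: "s \<in> I"
  let ?f = "\<lambda>u. g (t - 1) u / h (t - 1) (t - 1) u +
      (b (t - 1) + (\<Sum>l\<in>{t..<k}. b l * (h l (t - 1) u / h (t - 1) (t - 1) u)))"
  have "(?f has_real_derivative g t s + (0 + (\<Sum>l\<in>{t..<k}. b l * h l t s))) (at s within I)"
    by (intro DERIV_add g DERIV_const DERIV_sum DERIV_cmult deriv_next) (use t s n(2) in auto)
  moreover have "?f u = (g (t - 1) u + (\<Sum>l\<in>{t - 1..<k}. b l * h l (t - 1) u)) / h (t - 1) (t - 1) u"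
    if "u \<in> I" for u
  proof -
    have "{t - 1..<k} = insert (t - 1) {t..<k}" "t - 1 \<notin> {t..<k}"
      using t n(2) by auto
    then have "(\<Sum>l\<in>{t - 1..<k}. b l * h l (t - 1) u) =
        b (t - 1) * h (t - 1) (t - 1) u + (\<Sum>l\<in>{t..<k}. b l * h l (t - 1) u)"
      by simp
    moreover have "h (t - 1) (t - 1) u \<noteq> 0"
      using t n(2) that by (intro diagonal_nonzero) auto
    ultimately show ?thesis
      by (simp add: add_divide_distrib sum_divide_distrib)
  qed
  ultimately have "((\<lambda>u. (g (t - 1) u + (\<Sum>l\<in>{t - 1..<k}. b l * h l (t - 1) u)) / h (t - 1) (t - 1) u)
      has_real_derivative g t s + (0 + (\<Sum>l\<in>{t..<k}. b l * h l t s))) (at s within I)"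
    by (rule has_field_derivative_transform_within[OF _ zero_less_one s])
  then show "((\<lambda>u. (g (t - 1) u + (\<Sum>l\<in>{t - 1..<k}. b l * h l (t - 1) u)) / h (t - 1) (t - 1) u)
      has_real_derivative g t s + (\<Sum>l\<in>{t..<k}. b l * h l t s)) (at s within I)"
    by simp
next
  show "sgn (h t t s) = diag_sgn t" if "t \<in> {1..<n}" "s \<in> I" for t s
    using that n(2) by (intro diag_sgn) auto
qed (use xs in auto)

text \<open>If \<open>b\<^sub>j\<close> is the last nonzero coefficient, the \<open>j\<close>-th function of the chain is \<open>b\<^sub>j f\<^bsub>j,j\<^esub>\<close>, which has a
  strict constant sign. As \<open>j < k\<close>, at least two alternating points are left at that stage.\<close>

lemma alternation_imp_zero:
  assumes "weakly_alternates \<sigma> (\<lambda>s. \<Sum>l\<in>{1..<k}. b l * h l 1 s) xs" "\<sigma> \<noteq> 0"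
    "sorted_wrt (<) xs" "set xs \<subseteq> I" "k \<le> length xs"
    and "l \<in> {1..<k}"
  shows "b l = 0"
proof (rule ccontr)
  assume "b l \<noteq> 0"
  define j where "j = Max {l\<in>{1..<k}. b l \<noteq> 0}"
  have "j \<in> {l\<in>{1..<k}. b l \<noteq> 0}"
    unfolding j_def using \<open>b l \<noteq> 0\<close> assms(6) by (intro Max_in) auto
  then have j: "j \<in> {1..<k}" "b j \<noteq> 0" by auto
  have above: "b i = 0" if "i \<in> {1..<k}" "j < i" for i
  proof (rule ccontr)
    assume "b i \<noteq> 0"
    then have "i \<le> j"
      unfolding j_def using that by (intro Max_ge) auto
    with that show False by simp
  qed
  let ?\<sigma> = "(- 1) ^ (j - 1) * \<sigma> * (\<Prod>t\<in>{1..<j}. diag_sgn t)"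
  have "\<exists>ys. length ys = length xs - (j - 1) \<and> sorted_wrt (<) ys \<and> set ys \<subseteq> I \<and>
           weakly_alternates ?\<sigma> (\<lambda>s. 0 + (\<Sum>l\<in>{j..<k}. b l * h l j s)) ys"
    using j(1) assms(5) by (intro chain_alternation[where g = "\<lambda>_ _. 0"]) (use assms(1-4) in auto)
  then obtain ys where ys: "length ys = length xs - (j - 1)" "sorted_wrt (<) ys" "set ys \<subseteq> I"
      "weakly_alternates ?\<sigma> (\<lambda>s. 0 + (\<Sum>l\<in>{j..<k}. b l * h l j s)) ys"
    by blast
  have "2 \<le> length ys"
    using ys(1) assms(5) j(1) unfolding atLeastLessThan_iff by arith
  then obtain x y zs where "ys = x # y # zs"
    by (cases ys; cases "tl ys") auto
  moreover have "(\<Sum>l\<in>{j..<k}. b l * h l j s) = b j * h j j s" for s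
    using j(1) above by (subst sum.mono_neutral_right[of _ "{j}"]) auto
  ultimately have xy: "x \<in> I" "y \<in> I" "0 \<le> ?\<sigma> * (b j * h j j x)" "0 \<le> - ?\<sigma> * (b j * h j j y)"
    using ys(3,4) by simp_all
  have "diag_sgn t \<noteq> 0" if "t \<in> {1..<k}" for t
    using diagonal_nonzero[OF that xy(1)] by (simp add: diag_sgn[OF that xy(1), symmetric] sgn_zero_iff)
  then have "(\<Prod>t\<in>{1..<j}. diag_sgn t) \<noteq> 0"
    using j(1) by simp
  moreover define c where "c = ?\<sigma> * b j"
  ultimately have c: "c \<noteq> 0"
    using j(2) assms(2) by simp
  have nz: "h j j x \<noteq> 0" "h j j y \<noteq> 0"
    using diagonal_nonzero[OF j(1)] xy(1,2) by simp_all
  have "sgn (h j j x * h j j y) = sgn (h j j x) * sgn (h j j x)"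
    using diag_sgn[OF j(1)] xy(1,2) by (simp add: sgn_mult)
  then have "0 < h j j x * h j j y"
    using nz by (simp add: sgn_real_def split: if_splits)
  then have "0 < c\<^sup>2 * (h j j x * h j j y)"
    using c by simp
  also have "\<dots> = (c * h j j x) * (c * h j j y)"
    by (simp only: power2_eq_square ac_simps)
  also have "\<dots> \<le> 0"
  proof (rule mult_nonneg_nonpos)
    show "0 \<le> c * h j j x"
      using xy(3) by (simp add: c_def mult.assoc)
    show "c * h j j y \<le> 0"
      using xy(4) by (simp add: c_def mult.assoc)
  qed
  finally show False by simp
qed

lemma alternation_top_sign:
  assumes "weakly_alternates \<sigma> (\<lambda>s. g 1 s + (\<Sum>l\<in>{1..<k}. b l * h l 1 s)) xs"
    "sorted_wrt (<) xs" "set xs \<subseteq> I" "length xs = k"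
    and g: "\<And>t s. t \<in> {2..k} \<Longrightarrow> s \<in> I \<Longrightarrow>
      ((\<lambda>u. g (t - 1) u / h (t - 1) (t - 1) u) has_real_derivative g t s) (at s within I)"
  shows "\<exists>s\<in>I. 0 \<le> (- 1) ^ (k - 1) * \<sigma> * ((\<Prod>l\<in>{1..<k}. h l l s) * g k s)"
proof -
  let ?\<tau> = "\<Prod>t\<in>{1..<k}. diag_sgn t"
  obtain ys where ys: "length ys = length xs - (k - 1)" "set ys \<subseteq> I"
      "weakly_alternates ((- 1) ^ (k - 1) * \<sigma> * ?\<tau>) (\<lambda>s. g k s + (\<Sum>l\<in>{k..<k}. b l * h l k s)) ys"
    using chain_alternation[OF k_pos order_refl g assms(1-3)] assms(4) by auto
  obtain s zs where "ys = s # zs"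
    using ys(1) assms(4) k_pos by (cases ys) simp_all
  then have s: "s \<in> I" "0 \<le> (- 1) ^ (k - 1) * \<sigma> * ?\<tau> * g k s"
    using ys(2,3) by simp_all
  define H where "H = (\<Prod>l\<in>{1..<k}. h l l s)"
  have "?\<tau> = sgn H"
    unfolding H_def sgn_prod using diag_sgn s(1) by (intro prod.cong) auto
  then have "H = ?\<tau> * \<bar>H\<bar>"
    by (simp add: sgn_mult_abs)
  then have "(- 1) ^ (k - 1) * \<sigma> * (H * g k s) = (- 1) ^ (k - 1) * \<sigma> * (?\<tau> * \<bar>H\<bar> * g k s)"
    by simp
  also have "\<dots> = ((- 1) ^ (k - 1) * \<sigma> * ?\<tau> * g k s) * \<bar>H\<bar>"
    by (simp only: ac_simps)
  also have "\<dots> \<ge> 0"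
    by (rule mult_nonneg_nonneg[OF s(2) abs_ge_zero])
  finally show ?thesis
    using s(1) unfolding H_def by blast
qed

text \<open>The supports of the designs in the class, transformed to \<open>I\<close>: with the non-fixed points counted
  twice they carry exactly \<open>k\<close> conditions.\<close>

definition saturated :: "(nat \<Rightarrow> real) \<Rightarrow> bool" where
  "saturated p \<longleftrightarrow> inj_on p {1..m} \<and> p ` {1..m} \<subseteq> I \<and>
     (lo \<longrightarrow> (\<exists>s\<in>p ` {1..m}. \<forall>t\<in>I. s \<le> t)) \<and> (hi \<longrightarrow> (\<exists>s\<in>p ` {1..m}. \<forall>t\<in>I. t \<le> s))"

lemma span_derivative:
  assumes "s \<in> I"
  shows "((\<lambda>u. b0 + (\<Sum>l\<in>{1..<k}. b l * \<Psi> l u)) has_real_derivative (\<Sum>l\<in>{1..<k}. b l * h l 1 s)) (at s within I)"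
proof -
  have "((\<lambda>u. b0 + (\<Sum>l\<in>{1..<k}. b l * \<Psi> l u)) has_real_derivative 0 + (\<Sum>l\<in>{1..<k}. b l * h l 1 s)) (at s within I)"
    by (intro DERIV_add DERIV_const DERIV_sum DERIV_cmult deriv_first assms)
  then show ?thesis by simp
qed

lemma alternation_of_saturated_zeros:
  assumes deriv: "\<And>s. s \<in> I \<Longrightarrow> (u has_real_derivative u' s) (at s within I)"
    and p: "saturated p"
    and zero: "\<And>i. i \<in> {1..m} \<Longrightarrow> u (p i) = 0"
    and crit: "\<And>i. i \<in> {1..m} \<Longrightarrow> p i \<notin> fixed_ends I lo hi \<Longrightarrow> u' (p i) = 0 \<or>
      (\<forall>t\<in>I. p i \<le> t) \<and> 0 \<le> - \<kappa> * u' (p i) \<or> (\<forall>t\<in>I. t \<le> p i) \<and> 0 \<le> \<kappa> * u' (p i)"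
    and s: "s \<in> I" "s \<notin> p ` {1..m}" "0 \<le> \<kappa> * u s"
  shows "\<exists>xs. length xs = k \<and> sorted_wrt (<) xs \<and> set xs \<subseteq> I \<and>
           weakly_alternates (if lo then \<kappa> else - \<kappa>) u' xs"
proof -
  have "card (p ` {1..m}) = m"
    using p by (simp add: saturated_def card_image)
  moreover have "\<exists>xs. length xs = 2 * card (p ` {1..m}) - of_bool lo - of_bool hi \<and>
      sorted_wrt (<) xs \<and> set xs \<subseteq> I \<and> weakly_alternates (if lo then \<kappa> else - \<kappa>) u' xs"
  proof (rule alternation_from_zeros[OF interval deriv _ _ _ _ _ _ s])
    fix t assume "t \<in> p ` {1..m}"
    then obtain i where i: "i \<in> {1..m}" "t = p i" by blast
    show "u t = 0"
      using zero[OF i(1)] i(2) by simp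
    assume "t \<notin> fixed_ends I lo hi"
    then show "u' t = 0 \<or> (\<forall>r\<in>I. t \<le> r) \<and> 0 \<le> - \<kappa> * u' t \<or> (\<forall>r\<in>I. r \<le> t) \<and> 0 \<le> \<kappa> * u' t"
      using crit[OF i(1)] unfolding i(2) by blast
  qed (use p[unfolded saturated_def] in simp_all)
  ultimately show ?thesis
    by (simp add: k_eq)
qed

lemma span_zero_coefficients:
  assumes p: "saturated p"
    and "\<kappa> \<noteq> 0"
    and zero: "\<And>i. i \<in> {1..m} \<Longrightarrow> b0 + (\<Sum>l\<in>{1..<k}. b l * \<Psi> l (p i)) = 0"
    and crit: "\<And>i u'. i \<in> {1..m} \<Longrightarrow> p i \<notin> fixed_ends I lo hi \<Longrightarrow> u' = (\<Sum>l\<in>{1..<k}. b l * h l 1 (p i)) \<Longrightarrow>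
      u' = 0 \<or> (\<forall>t\<in>I. p i \<le> t) \<and> 0 \<le> - \<kappa> * u' \<or> (\<forall>t\<in>I. t \<le> p i) \<and> 0 \<le> \<kappa> * u'"
    and s: "s \<in> I" "s \<notin> p ` {1..m}" "0 \<le> \<kappa> * (b0 + (\<Sum>l\<in>{1..<k}. b l * \<Psi> l s))"
    and "l \<in> {1..<k}"
  shows "b l = 0"
proof -
  obtain xs where "length xs = k" "sorted_wrt (<) xs" "set xs \<subseteq> I"
      "weakly_alternates (if lo then \<kappa> else - \<kappa>) (\<lambda>s. \<Sum>l\<in>{1..<k}. b l * h l 1 s) xs"
    using alternation_of_saturated_zeros[OF span_derivative p zero crit s] by blast
  with alternation_imp_zero[OF this(4) _ this(2,3) _ \<open>l \<in> {1..<k}\<close>] show ?thesis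
    using \<open>\<kappa> \<noteq> 0\<close> by (auto split: if_splits)
qed

text \<open>A negative value, together with the zeros, would leave \<open>k\<close> alternating points for the derivative
  and hence make the function constant. A non-fixed endpoint may be a simple zero from which the
  function increases into the interval; this is what makes directions in parameter space point inwards.\<close>

lemma span_nonneg:
  assumes p: "saturated p"
    and zero: "\<And>i. i \<in> {1..m} \<Longrightarrow> b0 + (\<Sum>l\<in>{1..<k}. b l * \<Psi> l (p i)) = 0"
    and crit: "\<And>i u'. i \<in> {1..m} \<Longrightarrow> p i \<notin> fixed_ends I lo hi \<Longrightarrow> u' = (\<Sum>l\<in>{1..<k}. b l * h l 1 (p i)) \<Longrightarrow>
      u' = 0 \<or> (\<forall>t\<in>I. p i \<le> t) \<and> 0 \<le> u' \<or> (\<forall>t\<in>I. t \<le> p i) \<and> u' \<le> 0"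
    and s: "s \<in> I"
  shows "0 \<le> b0 + (\<Sum>l\<in>{1..<k}. b l * \<Psi> l s)"
proof (rule ccontr)
  assume neg: "\<not> ?thesis"
  have "s \<notin> p ` {1..m}"
    using neg zero by force
  have "b l = 0" if "l \<in> {1..<k}" for l
    by (rule span_zero_coefficients[OF p, of "-1" b0 b s])
      (use zero crit s neg that \<open>s \<notin> p ` {1..m}\<close> in auto)
  then have "b0 + (\<Sum>l\<in>{1..<k}. b l * \<Psi> l (p 1)) = b0 + (\<Sum>l\<in>{1..<k}. b l * \<Psi> l s)"
    by simp
  with zero[of 1] m_ge neg show False by simp
qed

text \<open>The analogue of the error formula of Hermite interpolation: the sign of the interpolation error is that
  of the top function of the chain, corrected by the parity of the number of nodes.\<close>

lemma top_nonpos: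
  assumes p: "saturated p"
    and y: "\<And>s. s \<in> I \<Longrightarrow> (y has_real_derivative g 1 s) (at s within I)"
    and g: "\<And>t s. t \<in> {2..k} \<Longrightarrow> s \<in> I \<Longrightarrow>
      ((\<lambda>u. g (t - 1) u / h (t - 1) (t - 1) u) has_real_derivative g t s) (at s within I)"
    and top: "\<And>s. s \<in> I \<Longrightarrow> 0 < (if hi then 1 else - 1) * ((\<Prod>l\<in>{1..<k}. h l l s) * g k s)"
    and zero: "\<And>i. i \<in> {1..m} \<Longrightarrow> y (p i) + (b0 + (\<Sum>l\<in>{1..<k}. b l * \<Psi> l (p i))) = 0"
    and crit: "\<And>i. i \<in> {1..m} \<Longrightarrow> p i \<notin> fixed_ends I lo hi \<Longrightarrow>
      g 1 (p i) + (\<Sum>l\<in>{1..<k}. b l * h l 1 (p i)) = 0"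
    and s: "s \<in> I"
  shows "y s + (b0 + (\<Sum>l\<in>{1..<k}. b l * \<Psi> l s)) \<le> 0"
proof (rule ccontr)
  assume pos: "\<not> ?thesis"
  let ?u = "\<lambda>s. y s + (b0 + (\<Sum>l\<in>{1..<k}. b l * \<Psi> l s))"
  let ?\<sigma> = "if lo then 1 else - 1 :: real"
  have "(?u has_real_derivative g 1 s + (\<Sum>l\<in>{1..<k}. b l * h l 1 s)) (at s within I)" if "s \<in> I" for s
    by (intro DERIV_add y span_derivative that)
  moreover have "s \<notin> p ` {1..m}"
    using pos zero by force
  ultimately have "\<exists>xs. length xs = k \<and> sorted_wrt (<) xs \<and> set xs \<subseteq> I \<and>
      weakly_alternates ?\<sigma> (\<lambda>s. g 1 s + (\<Sum>l\<in>{1..<k}. b l * h l 1 s)) xs"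
    using crit pos by (intro alternation_of_saturated_zeros[of ?u _ p, OF _ p zero _ s]) simp_all
  then obtain xs where xs: "length xs = k" "sorted_wrt (<) xs" "set xs \<subseteq> I"
      "weakly_alternates ?\<sigma> (\<lambda>s. g 1 s + (\<Sum>l\<in>{1..<k}. b l * h l 1 s)) xs"
    by blast
  obtain t where t: "t \<in> I" "0 \<le> (- 1) ^ (k - 1) * ?\<sigma> * ((\<Prod>l\<in>{1..<k}. h l l t) * g k t)"
    using alternation_top_sign[OF xs(4,2,3,1) g] by blast
  have "(- 1) ^ (k - 1) * ?\<sigma> = (if hi then - 1 else 1)"
  proof -
    define j where "j = m - 2"
    have j: "m = Suc (Suc j)"
      using m_ge by (simp add: j_def)
    show ?thesis
      unfolding k_eq j by (cases lo; cases hi) simp_all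
  qed
  with top[OF t(1)] t(2) show False by (auto split: if_splits)
qed

end

section \<open>Moments and interpolation\<close>

text \<open>The functions \<open>\<Psi>\<^sub>1, \<dots>, \<Psi>\<^sub>k\<^sub>-\<^sub>1\<close> are indexed by the same finite type as the coordinates of the design
  parameter, which is possible since there are equally many. The derivative of the moments with
  respect to the parameter then becomes a square matrix.\<close>

locale chebyshev_coordinates = chebyshev_chain +
  fixes \<pi> :: "nat \<Rightarrow> 'z::finite"
  assumes coordinates: "bij_betw \<pi> {1..<k} UNIV"
begin

definition moment :: "real \<Rightarrow> real^'z" where
  "moment s = (\<chi> z. \<Psi> (inv_into {1..<k} \<pi> z) s)"

definition moment_deriv :: "real \<Rightarrow> real^'z" where
  "moment_deriv s = (\<chi> z. h (inv_into {1..<k} \<pi> z) 1 s)"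

lemma inner_moment: "a \<bullet> moment s = (\<Sum>l\<in>{1..<k}. a $ \<pi> l * \<Psi> l s)"
  using bij_betw_inv_into_left[OF coordinates]
  by (simp add: inner_vec_def moment_def flip: sum.reindex_bij_betw[OF coordinates])

lemma inner_moment_deriv: "a \<bullet> moment_deriv s = (\<Sum>l\<in>{1..<k}. a $ \<pi> l * h l 1 s)"
  using bij_betw_inv_into_left[OF coordinates]
  by (simp add: inner_vec_def moment_deriv_def flip: sum.reindex_bij_betw[OF coordinates])

lemma eq_zero_if_coordinates: "(\<And>l. l \<in> {1..<k} \<Longrightarrow> a $ \<pi> l = 0) \<Longrightarrow> a = 0"
proof -
  assume zero: "\<And>l. l \<in> {1..<k} \<Longrightarrow> a $ \<pi> l = 0"
  have "a $ z = 0" for z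
  proof -
    have "z \<in> \<pi> ` {1..<k}"
      using bij_betw_imp_surj_on[OF coordinates] by simp
    then show ?thesis
      using zero by blast
  qed
  then show ?thesis
    by (simp add: vec_eq_iff)
qed

lemma inner_moment_has_derivative:
  assumes "s \<in> I"
  shows "((\<lambda>u. a \<bullet> moment u) has_real_derivative a \<bullet> moment_deriv s) (at s within I)"
  using span_derivative[OF assms, of 0 "\<lambda>l. a $ \<pi> l"] by (simp add: inner_moment inner_moment_deriv)

lemma moment_has_derivative:
  assumes "s \<in> I"
  shows "(moment has_vector_derivative moment_deriv s) (at s within I)"
  unfolding has_vector_derivative_def
proof (subst has_derivative_componentwise_within, rule ballI)
  fix i :: "real^'z" assume "i \<in> Basis"
  show "((\<lambda>u. moment u \<bullet> i) has_derivative (\<lambda>u. u *\<^sub>R moment_deriv s \<bullet> i)) (at s within I)"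
    using inner_moment_has_derivative[OF assms, of i]
    by (simp add: has_field_derivative_def inner_commute mult.commute[of _ "_ \<bullet> _"])
qed

text \<open>A function \<open>a \<bullet> moment\<close> that is constant takes its value at \<open>k + 1\<close> points, so the derivative
  alternates weakly at \<open>k\<close> points.\<close>

lemma moment_not_in_hyperplane:
  assumes "\<And>s. s \<in> I \<Longrightarrow> a \<bullet> moment s = b"
  shows "a = 0"
proof (rule eq_zero_if_coordinates)
  fix l assume l: "l \<in> {1..<k}"
  obtain S where S: "finite S" "card S = Suc k" "S \<subseteq> I"
    using infinite_arbitrarily_large[OF infinite] by blast
  define xs where "xs = sorted_list_of_set S"
  have xs: "length xs = Suc k" "sorted_wrt (<) xs" "set xs \<subseteq> I"
    using S by (simp_all add: xs_def)
  then obtain x xs' where x: "xs = x # xs'"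
    by (cases xs) auto
  have "weakly_alternates \<sigma> (\<lambda>s. a \<bullet> moment s - b) ys" if "set ys \<subseteq> I" for \<sigma> ys
    using that assms by (induction ys arbitrary: \<sigma>) auto
  then have "weakly_alternates 1 (\<lambda>s. a \<bullet> moment s - b) (x # xs')"
    using xs(3) x by blast
  moreover have "((\<lambda>u. a \<bullet> moment u - b) has_real_derivative a \<bullet> moment_deriv s) (at s within I)"
    if "s \<in> I" for s
    using DERIV_diff[OF inner_moment_has_derivative[OF that, of a] DERIV_const[of b]] by simp
  ultimately have "\<exists>ys. length ys = length xs' \<and> sorted_wrt (<) (x # ys) \<and> set ys \<subseteq> I \<and>
      weakly_alternates (- 1) (\<lambda>s. a \<bullet> moment_deriv s) ys"
    using xs(2,3) x by (intro weakly_alternates_derivative[OF interval]) auto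
  then obtain ys where ys: "length ys = length xs'" "sorted_wrt (<) (x # ys)" "set ys \<subseteq> I"
      "weakly_alternates (- 1) (\<lambda>s. a \<bullet> moment_deriv s) ys"
    by blast
  show "a $ \<pi> l = 0"
  proof (rule alternation_imp_zero[OF _ _ _ ys(3) _ l])
    show "weakly_alternates (- 1) (\<lambda>s. \<Sum>l\<in>{1..<k}. a $ \<pi> l * h l 1 s) ys"
      using ys(4) by (simp add: inner_moment_deriv)
  qed (use ys xs(1) x in auto)
qed

definition nonfixed_indices :: "(nat \<Rightarrow> real) \<Rightarrow> nat set" where
  "nonfixed_indices p = {i\<in>{1..m}. p i \<notin> fixed_ends I lo hi}"

text \<open>Up to transposition this is the derivative of the moments with respect to the design parameter if
  \<open>\<kappa> i\<close> is the weight times the derivative of the transformation at the point, and the matrix of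
  Hermite interpolation (up to the additive constant) if \<open>\<kappa> i = 1\<close>.\<close>

definition design_jacobian ::
  "(nat \<Rightarrow> real) \<Rightarrow> (nat \<Rightarrow> real) \<Rightarrow> (nat + nat \<Rightarrow> 'z) \<Rightarrow> real^'z^'z" where
  "design_jacobian p \<kappa> e =
     (\<chi> z. case inv_into (nonfixed_indices p <+> {2..m}) e z of
        Inl i \<Rightarrow> \<kappa> i *\<^sub>R moment_deriv (p i) | Inr i \<Rightarrow> moment (p i) - moment (p 1))"

context
  fixes p :: "nat \<Rightarrow> real" and e :: "nat + nat \<Rightarrow> 'z"
  assumes p: "saturated p"
    and e: "bij_betw e (nonfixed_indices p <+> {2..m}) UNIV"
begin

lemma design_jacobian_rows:
  "i \<in> nonfixed_indices p \<Longrightarrow> design_jacobian p \<kappa> e $ e (Inl i) = \<kappa> i *\<^sub>R moment_deriv (p i)"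
  "i \<in> {2..m} \<Longrightarrow> design_jacobian p \<kappa> e $ e (Inr i) = moment (p i) - moment (p 1)"
  using bij_betw_inv_into_left[OF e, of "Inl i"] bij_betw_inv_into_left[OF e, of "Inr i"]
  by (simp_all add: design_jacobian_def InlI InrI)

text \<open>A vector in the kernel gives a function of the span with \<open>k\<close> zeros, which has to vanish.\<close>

lemma invertible_design_jacobian:
  assumes \<kappa>: "\<And>i. i \<in> nonfixed_indices p \<Longrightarrow> \<kappa> i \<noteq> 0"
  shows "invertible (design_jacobian p \<kappa> e)"
proof -
  let ?J = "design_jacobian p \<kappa> e"
  have "a = 0" if "?J *v a = 0" for a
  proof (rule eq_zero_if_coordinates)
    have row: "?J $ z \<bullet> a = 0" for z
      using that by (metis matrix_vector_mul_component zero_index)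
    have zero: "- (a \<bullet> moment (p 1)) + (\<Sum>l\<in>{1..<k}. a $ \<pi> l * \<Psi> l (p i)) = 0" if "i \<in> {1..m}" for i
    proof (cases "i = 1")
      case True
      then show ?thesis by (simp add: inner_moment)
    next
      case False
      then have i: "i \<in> {2..m}" using that by auto
      then show ?thesis
        using row[of "e (Inr i)"] design_jacobian_rows(2)[OF i]
        by (simp add: inner_diff_right inner_moment inner_commute[of _ a])
    qed
    have crit: "(\<Sum>l\<in>{1..<k}. a $ \<pi> l * h l 1 (p i)) = 0"
      if "i \<in> {1..m}" "p i \<notin> fixed_ends I lo hi" for i
    proof -
      have i: "i \<in> nonfixed_indices p"
        using that by (simp add: nonfixed_indices_def)
      then show ?thesis
        using row[of "e (Inl i)"] design_jacobian_rows(1)[OF i] \<kappa>[OF i]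
        by (simp add: inner_commute[of _ a] inner_moment_deriv)
    qed
    have "infinite (I - p ` {1..m})"
      using infinite by (simp add: Diff_infinite_finite)
    then obtain s where s: "s \<in> I" "s \<notin> p ` {1..m}"
      by (metis Diff_iff ex_in_conv finite.emptyI)
    \<comment> \<open>Any further point serves as the extra sign; \<open>\<kappa>\<close> is adapted to the value there.\<close>
    define v where "v = - (a \<bullet> moment (p 1)) + (\<Sum>l\<in>{1..<k}. a $ \<pi> l * \<Psi> l s)"
    fix l assume l: "l \<in> {1..<k}"
    show "a $ \<pi> l = 0"
    proof (rule span_zero_coefficients[OF p, of "if v \<ge> 0 then 1 else -1" "- (a \<bullet> moment (p 1))" "\<lambda>l. a $ \<pi> l" s l])
      show "0 \<le> (if v \<ge> 0 then 1 else -1) * (- (a \<bullet> moment (p 1)) + (\<Sum>l\<in>{1..<k}. a $ \<pi> l * \<Psi> l s))"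
        unfolding v_def[symmetric] by simp
    qed (use zero crit s l in auto)
  qed
  then have "inj ((*v) ?J)"
    by (intro linear_injective_0[OF matrix_vector_mul_linear, THEN iffD2]) blast
  then show ?thesis
    unfolding invertible_left_inverse using matrix_left_invertible_injective by blast
qed

lemma interpolation:
  assumes \<kappa>: "\<And>i. i \<in> nonfixed_indices p \<Longrightarrow> \<kappa> i \<noteq> 0"
  obtains a where
    "\<And>i. i \<in> nonfixed_indices p \<Longrightarrow> \<kappa> i * (a \<bullet> moment_deriv (p i)) = r $ e (Inl i)"
    "\<And>i. i \<in> {2..m} \<Longrightarrow> a \<bullet> moment (p i) - a \<bullet> moment (p 1) = r $ e (Inr i)"
    "design_jacobian p \<kappa> e *v a = r"
proof -
  let ?J = "design_jacobian p \<kappa> e"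
  obtain B where "?J ** B = mat 1"
    using invertible_design_jacobian[of \<kappa>] \<kappa> unfolding invertible_def by blast
  then have a: "?J *v (B *v r) = r"
    by (simp add: matrix_vector_mul_assoc)
  then have row: "?J $ z \<bullet> (B *v r) = r $ z" for z
    by (metis matrix_vector_mul_component)
  show thesis
  proof (rule that[of "B *v r"])
    show "\<kappa> i * ((B *v r) \<bullet> moment_deriv (p i)) = r $ e (Inl i)" if "i \<in> nonfixed_indices p" for i
      using row[of "e (Inl i)"] design_jacobian_rows(1)[OF that, of \<kappa>] by (simp add: inner_commute)
    show "(B *v r) \<bullet> moment (p i) - (B *v r) \<bullet> moment (p 1) = r $ e (Inr i)" if "i \<in> {2..m}" for i
      using row[of "e (Inr i)"] design_jacobian_rows(2)[OF that, of \<kappa>]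
      by (simp add: inner_commute inner_diff_left inner_diff_right)
  qed (fact a)
qed

text \<open>The Hermite interpolant of \<open>y\<close> at a saturated configuration lies above \<open>y\<close>.\<close>

lemma top_majorant:
  assumes y: "\<And>s. s \<in> I \<Longrightarrow> (y has_real_derivative g 1 s) (at s within I)"
    and g: "\<And>t s. t \<in> {2..k} \<Longrightarrow> s \<in> I \<Longrightarrow>
      ((\<lambda>u. g (t - 1) u / h (t - 1) (t - 1) u) has_real_derivative g t s) (at s within I)"
    and top: "\<And>s. s \<in> I \<Longrightarrow> 0 < (if hi then 1 else - 1) * ((\<Prod>l\<in>{1..<k}. h l l s) * g k s)"
  obtains a0 a where "\<And>s. s \<in> I \<Longrightarrow> y s \<le> a0 + a \<bullet> moment s"
    "\<And>i. i \<in> {1..m} \<Longrightarrow> y (p i) = a0 + a \<bullet> moment (p i)"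
proof -
  define r where "r = (\<chi> z. case inv_into (nonfixed_indices p <+> {2..m}) e z of
      Inl i \<Rightarrow> g 1 (p i) | Inr i \<Rightarrow> y (p i) - y (p 1))"
  obtain a where a: "\<And>i. i \<in> nonfixed_indices p \<Longrightarrow> 1 * (a \<bullet> moment_deriv (p i)) = r $ e (Inl i)"
    "\<And>i. i \<in> {2..m} \<Longrightarrow> a \<bullet> moment (p i) - a \<bullet> moment (p 1) = r $ e (Inr i)"
    by (rule interpolation[of "\<lambda>_. 1" r]) (simp, blast)
  have deriv: "a \<bullet> moment_deriv (p i) = g 1 (p i)" if "i \<in> nonfixed_indices p" for i
    using a(1)[OF that] bij_betw_inv_into_left[OF e, of "Inl i"] that by (simp add: r_def InlI InrI)
  have val2: "a \<bullet> moment (p i) - a \<bullet> moment (p 1) = y (p i) - y (p 1)" if "i \<in> {2..m}" for i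
    using a(2)[OF that] bij_betw_inv_into_left[OF e, of "Inr i"] that by (simp add: r_def InlI InrI)
  have val: "y (p i) = (y (p 1) - a \<bullet> moment (p 1)) + a \<bullet> moment (p i)" if "i \<in> {1..m}" for i
  proof (cases "i = 1")
    case False
    with that have "i \<in> {2..m}" by simp
    from val2[OF this] show ?thesis by simp
  qed simp
  define a0 where "a0 = y (p 1) - a \<bullet> moment (p 1)"
  have nonpos: "y s + (- a0 + (\<Sum>l\<in>{1..<k}. (- a) $ \<pi> l * \<Psi> l s)) \<le> 0" if "s \<in> I" for s
  proof (rule top_nonpos[OF p y g top _ _ that])
    show "y (p i) + (- a0 + (\<Sum>l\<in>{1..<k}. (- a) $ \<pi> l * \<Psi> l (p i))) = 0" if "i \<in> {1..m}" for i
      using val[OF that] unfolding inner_moment[symmetric] by (simp add: a0_def)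
    show "g 1 (p i) + (\<Sum>l\<in>{1..<k}. (- a) $ \<pi> l * h l 1 (p i)) = 0"
      if "i \<in> {1..m}" "p i \<notin> fixed_ends I lo hi" for i
      using deriv[of i] that unfolding inner_moment_deriv[symmetric] by (simp add: nonfixed_indices_def)
  qed
  have "y s \<le> a0 + a \<bullet> moment s" if "s \<in> I" for s
    using nonpos[OF that] unfolding inner_moment[symmetric] by simp
  moreover have "y (p i) = a0 + a \<bullet> moment (p i)" if "i \<in> {1..m}" for i
    using val[OF that] by (simp add: a0_def)
  ultimately show thesis
    by (rule that)
qed

end

end

section \<open>Designs as discrete probability measures\<close>

text \<open>The integral of \<open>g\<close> with respect to the design. With matrix-valued \<open>g\<close> it is the information
  matrix, with the functions \<open>\<Psi>\<^sub>l\<close> the vector of moments.\<close>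

definition design_mean :: "(real \<Rightarrow> 'v::real_vector) \<Rightarrow> design \<Rightarrow> 'v" where
  "design_mean g \<xi> = (\<Sum>(x, \<omega>)\<leftarrow>\<xi>. \<omega> *\<^sub>R g x)"

lemma info_matrix_eq_mean: "info_matrix M \<xi> = design_mean M \<xi>"
  by (simp add: info_matrix_def design_mean_def)

lemma design_mean_linear:
  assumes "linear F"
  shows "design_mean (\<lambda>x. F (g x)) \<xi> = F (design_mean g \<xi>)"
  by (induction \<xi>) (auto simp: design_mean_def linear_0[OF assms] linear_add[OF assms] linear_scale[OF assms])

lemma design_mean_add:
  "design_mean (\<lambda>x. f x + g x) \<xi> = design_mean f \<xi> + design_mean g \<xi>"
  by (induction \<xi>) (auto simp: design_mean_def scaleR_add_right)

lemma design_mean_const: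
  fixes a :: real
  assumes "\<xi> \<in> designs X"
  shows "design_mean (\<lambda>x. a) \<xi> = a"
proof -
  have "design_mean (\<lambda>x. a) \<xi> = (\<Sum>(x, \<omega>)\<leftarrow>\<xi>. \<omega>) * a"
    unfolding design_mean_def by (induction \<xi>) (auto simp: algebra_simps)
  then show ?thesis
    using assms by (simp add: designs_def)
qed

lemma design_mean_mono:
  fixes f g :: "real \<Rightarrow> real"
  assumes "\<xi> \<in> designs X" "\<And>x. x \<in> X \<Longrightarrow> f x \<le> g x"
  shows "design_mean f \<xi> \<le> design_mean g \<xi>"
  unfolding design_mean_def
  using assms by (intro sum_list_mono) (auto simp: designs_def intro!: mult_left_mono)

lemma design_mean_cong:
  assumes "\<xi> \<in> designs X" "\<And>x. x \<in> X \<Longrightarrow> f x = g x"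
  shows "design_mean f \<xi> = design_mean g \<xi>"
  unfolding design_mean_def
  using assms by (intro arg_cong[where f = sum_list] map_cong) (auto simp: designs_def)

definition mix :: "real \<Rightarrow> design \<Rightarrow> design \<Rightarrow> design" where
  "mix t \<xi> \<zeta> = map (\<lambda>(x, \<omega>). (x, (1 - t) * \<omega>)) \<xi> @ map (\<lambda>(x, \<omega>). (x, t * \<omega>)) \<zeta>"

lemma design_mean_scale: "design_mean g (map (\<lambda>(x, \<omega>). (x, t * \<omega>)) \<xi>) = t *\<^sub>R design_mean g \<xi>"
  by (induction \<xi>) (auto simp: design_mean_def scaleR_add_right)

lemma design_mean_mix: "design_mean g (mix t \<xi> \<zeta>) = (1 - t) *\<^sub>R design_mean g \<xi> + t *\<^sub>R design_mean g \<zeta>"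
  using design_mean_scale[of g "1 - t" \<xi>] design_mean_scale[of g t \<zeta>]
  by (simp add: mix_def design_mean_def)

lemma weight_sum_scale: "(\<Sum>(x, \<omega>)\<leftarrow>map (\<lambda>(x, \<omega>). (x, t * \<omega>)) \<xi>. \<omega>) = (t :: real) * (\<Sum>(x, \<omega>)\<leftarrow>\<xi>. \<omega>)"
  by (induction \<xi>) (auto simp: algebra_simps)

lemma mix_in_designs:
  assumes "\<xi> \<in> designs X" "\<zeta> \<in> designs X" "0 \<le> t" "t \<le> 1"
  shows "mix t \<xi> \<zeta> \<in> designs X"
proof -
  have "(\<Sum>(x, \<omega>)\<leftarrow>mix t \<xi> \<zeta>. \<omega>) = (1 - t) * (\<Sum>(x, \<omega>)\<leftarrow>\<xi>. \<omega>) + t * (\<Sum>(x, \<omega>)\<leftarrow>\<zeta>. \<omega>)"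
    using weight_sum_scale[of "1 - t" \<xi>] weight_sum_scale[of t \<zeta>] by (simp add: mix_def)
  then show ?thesis
    using assms by (auto simp: designs_def mix_def)
qed

lemma convex_design_means: "convex (design_mean g ` designs X)"
proof (rule convexI)
  fix a b u v assume "a \<in> design_mean g ` designs X" "b \<in> design_mean g ` designs X"
    and uv: "0 \<le> u" "0 \<le> v" "u + v = (1 :: real)"
  then obtain \<xi> \<zeta> where "\<xi> \<in> designs X" "\<zeta> \<in> designs X" "a = design_mean g \<xi>" "b = design_mean g \<zeta>"
    by blast
  moreover have "u = 1 - v" "v \<le> 1"
    using uv by simp_all
  ultimately show "u *\<^sub>R a + v *\<^sub>R b \<in> design_mean g ` designs X"
    using uv(2) by (intro image_eqI[of _ _ "mix v \<xi> \<zeta>"]) (simp_all add: design_mean_mix mix_in_designs)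
qed

lemma mean_of_point: "x \<in> X \<Longrightarrow> g x \<in> design_mean g ` designs X"
  by (intro image_eqI[of _ _ "[(x, 1)]"]) (auto simp: design_mean_def designs_def)

section \<open>Nonnegative definite information matrices\<close>

lemma linear_quadratic_form: "linear (\<lambda>A :: real^'n^'n. v \<bullet> (A *v v))"
  by (intro linearI)
    (simp_all add: matrix_vector_mult_add_rdistrib inner_add_right scaleR_matrix_vector_assoc[symmetric])

lemma fisher_info_NND:
  assumes "0 \<le> w x"
  shows "fisher_info w f x \<in> NND"
proof -
  have "v \<bullet> ((\<chi> i j. f x $ i * f x $ j) *v v) = (f x \<bullet> v)\<^sup>2" for v
    by (simp add: inner_vec_def matrix_vector_mult_def power2_eq_square sum_distrib_left
        sum_distrib_right mult.assoc mult.commute mult.left_commute)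
  then have "v \<bullet> (fisher_info w f x *v v) = w x * (f x \<bullet> v)\<^sup>2" for v
    by (simp add: fisher_info_def scaleR_matrix_vector_assoc[symmetric])
  moreover have "transpose (fisher_info w f x) = fisher_info w f x"
    by (simp add: fisher_info_def transpose_def vec_eq_iff mult.commute)
  ultimately show ?thesis
    using assms by (simp add: NND_def)
qed

lemma linear_transpose: "linear (transpose :: real^'n^'m \<Rightarrow> real^'m^'n)"
  by (intro linearI) (simp_all add: transpose_def vec_eq_iff)

lemma info_matrix_NND:
  assumes "\<xi> \<in> designs X" "\<And>x. x \<in> X \<Longrightarrow> M x \<in> NND"
  shows "info_matrix M \<xi> \<in> NND"
proof -
  have "transpose (design_mean M \<xi>) = design_mean (\<lambda>x. transpose (M x)) \<xi>"
    by (rule design_mean_linear[OF linear_transpose, symmetric])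
  also have "\<dots> = design_mean M \<xi>"
    using assms by (intro design_mean_cong) (auto simp: NND_def)
  finally have "transpose (design_mean M \<xi>) = design_mean M \<xi>" .
  moreover have "0 \<le> v \<bullet> (design_mean M \<xi> *v v)" for v
  proof -
    have "v \<bullet> (design_mean M \<xi> *v v) = design_mean (\<lambda>x. v \<bullet> (M x *v v)) \<xi>"
      by (rule design_mean_linear[OF linear_quadratic_form, symmetric])
    also have "\<dots> \<ge> design_mean (\<lambda>x. 0) \<xi>"
      using assms by (intro design_mean_mono) (auto simp: NND_def)
    finally show ?thesis
      using design_mean_const[OF assms(1), of 0] by simp
  qed
  ultimately show ?thesis
    by (simp add: NND_def info_matrix_eq_mean)
qed

lemma loewner_leI:
  assumes "A \<in> NND" "B \<in> NND" "\<And>v. v \<bullet> (A *v v) \<le> v \<bullet> (B *v v)"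
  shows "loewner_le A B"
  using assms linear_diff[OF linear_transpose, of B A]
  by (auto simp: loewner_le_def NND_def linear_diff[OF linear_quadratic_form])

section \<open>The parametrization by design points and weights\<close>

lemma design_mean_design_of:
  "design_mean g (design_of L U m Fix e Z) =
     (\<Sum>i\<in>{1..m}. weight_of m e Z i *\<^sub>R g (point_of L U m Fix e Z i))"
proof -
  have "design_mean g (design_of L U m Fix e Z) =
      (\<Sum>i\<leftarrow>[1..<m + 1]. weight_of m e Z i *\<^sub>R g (point_of L U m Fix e Z i))"
    by (simp add: design_mean_def design_of_def comp_def)
  also have "\<dots> = (\<Sum>i\<in>{1..<m + 1}. weight_of m e Z i *\<^sub>R g (point_of L U m Fix e Z i))"
    by (simp only: sum_list_distinct_conv_sum_set distinct_upt set_upt)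
  also have "{1..<m + 1} = {1..m}" by auto
  finally show ?thesis .
qed

lemma sum_weight_of:
  assumes "1 \<le> m"
  shows "(\<Sum>i\<in>{1..m}. weight_of m e Z i) = 1"
proof -
  have "{1..m} = insert 1 {2..m}" using assms by auto
  then have "(\<Sum>i\<in>{1..m}. weight_of m e Z i) = weight_of m e Z 1 + (\<Sum>i\<in>{2..m}. weight_of m e Z i)"
    by simp
  also have "(\<Sum>i\<in>{2..m}. weight_of m e Z i) = (\<Sum>i\<in>{2..m}. Z $ e (Inr i))"
    by (intro sum.cong) (auto simp: weight_of_def)
  finally show ?thesis
    by (simp add: weight_of_def)
qed

text \<open>The conditions that the weights sum to one and that there are at most \<open>m\<close> support points hold
  automatically for designs given by a vector \<open>Z\<close>.\<close>

lemma Z_domain_iff: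
  assumes "1 \<le> m"
  shows "Z \<in> Z_domain L U m Fix e \<longleftrightarrow>
    strict_mono_on {1..m} (point_of L U m Fix e Z) \<and>
    (\<forall>i\<in>{1..m}. point_of L U m Fix e Z i \<in> design_space L U \<and> 0 \<le> weight_of m e Z i) \<and>
    Fix \<subseteq> ereal ` point_of L U m Fix e Z ` {1..m}"
proof -
  have set: "set (design_of L U m Fix e Z) =
      (\<lambda>i. (point_of L U m Fix e Z i, weight_of m e Z i)) ` {1..m}"
    by (auto simp: design_of_def)
  then have fst: "fst ` set (design_of L U m Fix e Z) = point_of L U m Fix e Z ` {1..m}"
    by (simp add: image_image)
  have "(\<Sum>(x, \<omega>)\<leftarrow>design_of L U m Fix e Z. \<omega>) = design_mean (\<lambda>_. 1) (design_of L U m Fix e Z)"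
    by (simp add: design_mean_def)
  also have "\<dots> = 1"
    using sum_weight_of[OF assms, of e Z] by (simp add: design_mean_design_of)
  finally have sum: "(\<Sum>(x, \<omega>)\<leftarrow>design_of L U m Fix e Z. \<omega>) = 1" .
  have "card (point_of L U m Fix e Z ` {1..m}) \<le> m"
    using card_image_le[of "{1..m}" "point_of L U m Fix e Z"] by simp
  then show ?thesis
    unfolding Z_domain_def design_class_def designs_def mem_Collect_eq fst sum
    by (auto simp: set)
qed

section \<open>Complete class models\<close>

lemma is_interval_design_space: "is_interval (design_space L U)"
  unfolding is_interval_1
proof (intro ballI allI impI)
  fix a b x assume "a \<in> design_space L U" "b \<in> design_space L U" "a \<le> x \<and> x \<le> b"
  then have "L \<le> ereal a" "ereal a \<le> ereal x" "ereal x \<le> ereal b" "ereal b \<le> U"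
    by (simp_all add: design_space_def)
  then show "x \<in> design_space L U"
    unfolding design_space_def mem_Collect_eq by (blast intro: order_trans)
qed

lemma infinite_design_space:
  assumes "L < U"
  shows "infinite (design_space L U)"
proof -
  obtain a where a: "L < ereal a" "ereal a < U"
    using ereal_dense2[OF assms] by blast
  obtain b where b: "ereal a < ereal b" "ereal b < U"
    using ereal_dense2[OF a(2)] by blast
  have "{a..b} \<subseteq> design_space L U"
  proof
    fix x assume "x \<in> {a..b}"
    then have "ereal a \<le> ereal x" "ereal x \<le> ereal b" by simp_all
    then show "x \<in> design_space L U"
      using a b unfolding design_space_def by (metis (mono_tags, lifting) less_imp_le mem_Collect_eq order_trans)
  qed
  moreover have "infinite {a..b}"
    using b(1) by (simp add: infinite_Icc)
  ultimately show ?thesis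
    using finite_subset by blast
qed

lemma design_space_least_iff:
  assumes "L < U" "x \<in> design_space L U"
  shows "ereal x = L \<longleftrightarrow> (\<forall>t\<in>design_space L U. x \<le> t)"
proof
  assume "ereal x = L"
  then show "\<forall>t\<in>design_space L U. x \<le> t"
    by (auto simp: design_space_def)
next
  assume least: "\<forall>t\<in>design_space L U. x \<le> t"
  show "ereal x = L"
  proof (rule ccontr)
    assume "ereal x \<noteq> L"
    with assms(2) have "L < ereal x" by (auto simp: design_space_def)
    then obtain y where y: "L < ereal y" "ereal y < ereal x"
      using ereal_dense2 by blast
    moreover have "ereal x \<le> U"
      using assms(2) by (simp add: design_space_def)
    ultimately have "y \<in> design_space L U"
      unfolding design_space_def mem_Collect_eq by (meson less_imp_le order_trans)
    with least y(2) show False by auto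
  qed
qed

lemma design_space_greatest_iff:
  assumes "L < U" "x \<in> design_space L U"
  shows "ereal x = U \<longleftrightarrow> (\<forall>t\<in>design_space L U. t \<le> x)"
proof
  assume "ereal x = U"
  then show "\<forall>t\<in>design_space L U. t \<le> x"
    by (auto simp: design_space_def)
next
  assume greatest: "\<forall>t\<in>design_space L U. t \<le> x"
  show "ereal x = U"
  proof (rule ccontr)
    assume "ereal x \<noteq> U"
    with assms(2) have "ereal x < U" by (auto simp: design_space_def)
    then obtain y where y: "ereal x < ereal y" "ereal y < U"
      using ereal_dense2 by blast
    moreover have "L \<le> ereal x"
      using assms(2) by (simp add: design_space_def)
    ultimately have "y \<in> design_space L U"
      unfolding design_space_def mem_Collect_eq by (meson less_imp_le order_trans)
    with greatest y(1) show False by auto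
  qed
qed

lemma extremes_of_monotone_image:
  fixes c :: "real \<Rightarrow> real"
  assumes "x \<in> X"
  shows "strict_mono_on X c \<Longrightarrow> (\<forall>s\<in>c ` X. c x \<le> s) \<longleftrightarrow> (\<forall>t\<in>X. x \<le> t)"
    and "strict_mono_on X c \<Longrightarrow> (\<forall>s\<in>c ` X. s \<le> c x) \<longleftrightarrow> (\<forall>t\<in>X. t \<le> x)"
    and "strict_antimono_on X c \<Longrightarrow> (\<forall>s\<in>c ` X. c x \<le> s) \<longleftrightarrow> (\<forall>t\<in>X. t \<le> x)"
    and "strict_antimono_on X c \<Longrightarrow> (\<forall>s\<in>c ` X. s \<le> c x) \<longleftrightarrow> (\<forall>t\<in>X. x \<le> t)"
proof -
  have mono: "c x \<le> c t \<longleftrightarrow> x \<le> t" "c t \<le> c x \<longleftrightarrow> t \<le> x" if "strict_mono_on X c" "t \<in> X" for t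
    using monotone_onD[OF that(1) assms that(2)] monotone_onD[OF that(1) that(2) assms]
    by (cases x t rule: linorder_cases; simp)+
  have antimono: "c x \<le> c t \<longleftrightarrow> t \<le> x" "c t \<le> c x \<longleftrightarrow> x \<le> t" if "strict_antimono_on X c" "t \<in> X" for t
    using monotone_onD[OF that(1) assms that(2)] monotone_onD[OF that(1) that(2) assms]
    by (cases x t rule: linorder_cases; simp)+
  show "strict_mono_on X c \<Longrightarrow> (\<forall>s\<in>c ` X. c x \<le> s) \<longleftrightarrow> (\<forall>t\<in>X. x \<le> t)"
    "strict_mono_on X c \<Longrightarrow> (\<forall>s\<in>c ` X. s \<le> c x) \<longleftrightarrow> (\<forall>t\<in>X. t \<le> x)"
    using mono by simp_all
  show "strict_antimono_on X c \<Longrightarrow> (\<forall>s\<in>c ` X. c x \<le> s) \<longleftrightarrow> (\<forall>t\<in>X. t \<le> x)"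
    "strict_antimono_on X c \<Longrightarrow> (\<forall>s\<in>c ` X. s \<le> c x) \<longleftrightarrow> (\<forall>t\<in>X. x \<le> t)"
    using antimono by simp_all
qed

lemma increasing_derivative_nonneg:
  fixes c :: "real \<Rightarrow> real"
  assumes "is_interval X" "x \<in> X" "y \<in> X" "x \<noteq> y"
    and "(c has_real_derivative D) (at x within X)"
    and mono: "\<And>s t. s \<in> X \<Longrightarrow> t \<in> X \<Longrightarrow> s < t \<Longrightarrow> c s < c t"
  shows "0 \<le> D"
proof (rule ccontr)
  assume "\<not> 0 \<le> D"
  then have D: "D < 0" by simp
  show False
  proof (cases "x < y")
    case True
    obtain d where d: "d > 0" "\<And>r. 0 < r \<Longrightarrow> x + r \<in> X \<Longrightarrow> r < d \<Longrightarrow> c (x + r) < c x"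
      using has_real_derivative_neg_dec_right[OF assms(5) D] by blast
    define r where "r = min (d / 2) (y - x)"
    have r: "0 < r" "r < d" "x + r \<le> y"
      using d(1) True by (auto simp: r_def)
    then have "x + r \<in> X"
      using mem_is_interval_1_I[OF assms(1-3), of "x + r"] by simp
    with d(2)[of r] mono[of x "x + r"] r assms(2) show False by force
  next
    case False
    obtain d where d: "d > 0" "\<And>r. 0 < r \<Longrightarrow> x - r \<in> X \<Longrightarrow> r < d \<Longrightarrow> c (x - r) > c x"
      using has_real_derivative_neg_dec_left[OF assms(5) D] by blast
    define r where "r = min (d / 2) (x - y)"
    have r: "0 < r" "r < d" "y \<le> x - r"
      using d(1) False assms(4) by (auto simp: r_def)
    then have "x - r \<in> X"
      using mem_is_interval_1_I[OF assms(1,3,2), of "x - r"] by simp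
    with d(2)[of r] mono[of "x - r" x] r assms(2) show False by force
  qed
qed

text \<open>The complete class hypothesis with its existential witnesses fixed and its four cases merged
  through the flags \<open>lo\<close> and \<open>hi\<close>. The last assumptions about \<open>Fix\<close> express in terms of the interval
  \<open>c ` X\<close> which design points are fixed, so that later arguments need not distinguish increasing from
  decreasing transformations.\<close>

locale complete_class =
  chebyshev_coordinates "c ` design_space L U" k \<Psi> h lo hi m \<pi>
  for L U :: ereal and c :: "real \<Rightarrow> real" and k \<Psi> h lo hi m and \<pi> :: "nat \<Rightarrow> 'z::finite" +
  fixes M C :: "real \<Rightarrow> real^('p::finite + 'q::finite)^('p + 'q)"
    and P :: "real^('p + 'q)^('p + 'q)"
    and H :: "nat \<Rightarrow> real \<Rightarrow> real^'q^'q" and Fix :: "ereal set" and c' :: "real \<Rightarrow> real"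
    and e :: "nat + nat \<Rightarrow> 'z"
  assumes nontrivial: "L < U"
    and M_NND: "\<And>x. x \<in> design_space L U \<Longrightarrow> M x \<in> NND"
    and M_eq: "\<And>x. x \<in> design_space L U \<Longrightarrow> M x = P ** C (c x) ** transpose P"
    and C_sym: "\<And>s. s \<in> c ` design_space L U \<Longrightarrow> transpose (C s) = C s"
    and entries: "maximal_indep_entries (c ` design_space L U) C k \<Psi>"
    and chain: "derivative_chain (c ` design_space L U) k \<Psi> (\<lambda>s. lower_block (C s)) h H"
    and F_definite: "\<And>s. s \<in> c ` design_space L U \<Longrightarrow>
      (if hi then F_matrix k h H s else - F_matrix k h H s) \<in> PD"
    and c_mono: "strict_mono_on (design_space L U) c \<or> strict_antimono_on (design_space L U) c"
    and c_deriv: "\<And>x. x \<in> design_space L U \<Longrightarrow> (c has_real_derivative c' x) (at x within design_space L U)"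
    and c'_nonzero: "\<And>x. x \<in> design_space L U \<Longrightarrow> ereal x \<notin> Fix \<Longrightarrow> c' x \<noteq> 0"
    and Fix_subset: "Fix \<subseteq> {L, U}"
    and Fix_iff: "\<And>x. x \<in> design_space L U \<Longrightarrow>
      ereal x \<in> Fix \<longleftrightarrow> c x \<in> fixed_ends (c ` design_space L U) lo hi"
    and lo_attained: "\<And>Y. lo \<Longrightarrow> Y \<subseteq> design_space L U \<Longrightarrow> Fix \<subseteq> ereal ` Y \<Longrightarrow>
      \<exists>x\<in>Y. \<forall>t\<in>c ` design_space L U. c x \<le> t"
    and hi_attained: "\<And>Y. hi \<Longrightarrow> Y \<subseteq> design_space L U \<Longrightarrow> Fix \<subseteq> ereal ` Y \<Longrightarrow>
      \<exists>x\<in>Y. \<forall>t\<in>c ` design_space L U. t \<le> c x"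
    and e_labelling: "labelling L U m Fix e"
begin

abbreviation X :: "real set" where "X \<equiv> design_space L U"
abbreviation pt :: "real^'z \<Rightarrow> nat \<Rightarrow> real" where "pt \<equiv> point_of L U m Fix e"
abbreviation wt :: "real^'z \<Rightarrow> nat \<Rightarrow> real" where "wt \<equiv> weight_of m e"
abbreviation dsgn :: "real^'z \<Rightarrow> design" where "dsgn \<equiv> design_of L U m Fix e"
abbreviation dom :: "(real^'z) set" where "dom \<equiv> Z_domain L U m Fix e"

lemma c_inj: "inj_on c X"
  using c_mono by (auto simp: strict_mono_on_imp_inj_on strict_antimono_iff_antimono)

lemma domD:
  assumes "Z \<in> dom"
  shows "strict_mono_on {1..m} (pt Z)" "i \<in> {1..m} \<Longrightarrow> pt Z i \<in> X" "i \<in> {1..m} \<Longrightarrow> 0 \<le> wt Z i"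
    "Fix \<subseteq> ereal ` pt Z ` {1..m}" "dsgn Z \<in> designs X"
proof -
  show "strict_mono_on {1..m} (pt Z)" "i \<in> {1..m} \<Longrightarrow> pt Z i \<in> X" "i \<in> {1..m} \<Longrightarrow> 0 \<le> wt Z i"
    "Fix \<subseteq> ereal ` pt Z ` {1..m}"
    using assms m_ge by (simp_all add: Z_domain_iff)
  show "dsgn Z \<in> designs X"
    using assms by (simp add: Z_domain_def design_class_def)
qed

lemma saturated_dom:
  assumes "Z \<in> dom"
  shows "saturated (c \<circ> pt Z)"
  unfolding saturated_def
proof (intro conjI impI)
  have sub: "pt Z ` {1..m} \<subseteq> X"
    using domD(2)[OF assms] by blast
  have "inj_on (pt Z) {1..m}"
    using domD(1)[OF assms] by (rule strict_mono_on_imp_inj_on)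
  then show "inj_on (c \<circ> pt Z) {1..m}"
    using c_inj sub by (meson comp_inj_on inj_on_subset)
  show "(c \<circ> pt Z) ` {1..m} \<subseteq> c ` X"
    using sub by auto
  show "\<exists>s\<in>(c \<circ> pt Z) ` {1..m}. \<forall>t\<in>c ` X. s \<le> t" if lo
    using lo_attained[OF that sub domD(4)[OF assms]] by auto
  show "\<exists>s\<in>(c \<circ> pt Z) ` {1..m}. \<forall>t\<in>c ` X. t \<le> s" if hi
    using hi_attained[OF that sub domD(4)[OF assms]] by auto
qed

lemma nonfixed_iff:
  assumes "Z \<in> dom" "i \<in> {1..m}"
  shows "i \<in> nonfixed L U m Fix \<longleftrightarrow> ereal (pt Z i) \<notin> Fix"
proof
  assume i: "i \<in> nonfixed L U m Fix"
  show "ereal (pt Z i) \<notin> Fix"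
  proof
    assume "ereal (pt Z i) \<in> Fix"
    with Fix_subset consider "ereal (pt Z i) = L" "L \<in> Fix" | "ereal (pt Z i) = U" "U \<in> Fix"
      by auto
    then show False
    proof cases
      case 1
      have "real_of_ereal L = pt Z i"
        using arg_cong[OF 1(1), of real_of_ereal] by simp
      then have "pt Z 1 = pt Z i"
        using 1(2) point_of_def[of L U m Fix e Z 1] by simp
      moreover have "i \<noteq> 1"
        using i 1 by (auto simp: nonfixed_def)
      ultimately show False
        using strict_mono_onD[OF domD(1)[OF assms(1)], of 1 i] assms(2) by auto
    next
      case 2
      have "real_of_ereal U = pt Z i"
        using arg_cong[OF 2(1), of real_of_ereal] by simp
      then have "pt Z m = pt Z i"
        using 2(2) m_ge point_of_def[of L U m Fix e Z m] by simp
      moreover have "i \<noteq> m"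
        using i 2 by (auto simp: nonfixed_def)
      ultimately show False
        using strict_mono_onD[OF domD(1)[OF assms(1)], of i m] assms(2) by auto
    qed
  qed
next
  assume not: "ereal (pt Z i) \<notin> Fix"
  have "ereal (pt Z i) \<in> Fix" if "i \<notin> nonfixed L U m Fix"
  proof -
    have fixed: "i = 1 \<and> L \<in> Fix \<or> i = m \<and> U \<in> Fix"
      using that assms(2) by (auto simp: nonfixed_def)
    have "\<exists>v\<in>Fix. pt Z i = real_of_ereal v"
    proof (cases "i = 1 \<and> L \<in> Fix")
      case True
      then show ?thesis
        unfolding point_of_def if_P[OF True] by blast
    next
      case False
      with fixed have im: "i = m \<and> U \<in> Fix" by blast
      then show ?thesis
        unfolding point_of_def if_not_P[OF False] if_P[OF im] by blast
    qed
    then obtain v where v: "v \<in> Fix" "pt Z i = real_of_ereal v" by blast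
    then show ?thesis
      using domD(4)[OF assms(1)] by force
  qed
  with not show "i \<in> nonfixed L U m Fix" by blast
qed

lemma nonfixed_indices_dom:
  assumes "Z \<in> dom"
  shows "nonfixed_indices (c \<circ> pt Z) = nonfixed L U m Fix"
proof -
  have "c (pt Z i) \<notin> fixed_ends (c ` X) lo hi \<longleftrightarrow> i \<in> nonfixed L U m Fix" if "i \<in> {1..m}" for i
    using nonfixed_iff[OF assms that] Fix_iff[OF domD(2)[OF assms that]] by blast
  moreover have "nonfixed L U m Fix \<subseteq> {1..m}"
    by (auto simp: nonfixed_def)
  ultimately show ?thesis
    unfolding nonfixed_indices_def comp_def by blast
qed

lemma e_bij: "Z \<in> dom \<Longrightarrow> bij_betw e (nonfixed_indices (c \<circ> pt Z) <+> {2..m}) UNIV"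
  using e_labelling by (simp add: labelling_def nonfixed_indices_dom)

text \<open>By maximality a nonconstant entry depends linearly on \<open>\<Psi>\<^sub>1, \<dots>, \<Psi>\<^sub>k\<^sub>-\<^sub>1\<close>, and the coefficient of the entry
  itself is not zero because these functions are independent.\<close>

lemma entry_in_span:
  obtains a0 a where "\<And>s. s \<in> c ` X \<Longrightarrow> C s $ i $ Inl j = a0 + a \<bullet> moment s"
proof (cases "(\<lambda>s. C s $ i $ Inl j) constant_on c ` X")
  case True
  then obtain a0 where "\<And>s. s \<in> c ` X \<Longrightarrow> C s $ i $ Inl j = a0"
    unfolding constant_on_def by blast
  then show thesis
    using that[of a0 0] by simp
next
  case False
  let ?f = "\<lambda>s. C s $ i $ Inl j"
  have "\<not> lin_indep_on (c ` X) {1..k} (\<Psi>(k := ?f))"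
    using entries False unfolding maximal_indep_entries_def by blast
  then obtain b l where b: "\<And>s. s \<in> c ` X \<Longrightarrow> (\<Sum>l\<in>{1..k}. b l * (\<Psi>(k := ?f)) l s) = 0"
    and l: "l \<in> {1..k}" "b l \<noteq> 0"
    unfolding lin_indep_on_def by blast
  have "{1..k} = insert k {1..<k}" using k_pos by auto
  then have eq: "b k * ?f s + (\<Sum>l\<in>{1..<k}. b l * \<Psi> l s) = 0" if "s \<in> c ` X" for s
    using b[OF that] by (simp add: sum.insert)
  have "b k \<noteq> 0"
  proof
    assume "b k = 0"
    then have "\<forall>s\<in>c ` X. (\<Sum>l\<in>{1..<k}. b l * \<Psi> l s) = 0"
      using eq by simp
    then have "\<forall>l\<in>{1..<k}. b l = 0"
      using entries unfolding maximal_indep_entries_def lin_indep_on_def by blast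
    with l \<open>b k = 0\<close> show False
      by (cases "l = k") auto
  qed
  define a where "a = (\<chi> z. - b (inv_into {1..<k} \<pi> z) / b k)"
  have a: "a $ \<pi> l = - b l / b k" if "l \<in> {1..<k}" for l
    using bij_betw_inv_into_left[OF coordinates that] by (simp add: a_def)
  have "?f s = 0 + a \<bullet> moment s" if "s \<in> c ` X" for s
  proof -
    have "a \<bullet> moment s = (\<Sum>l\<in>{1..<k}. - (b l * \<Psi> l s) / b k)"
      unfolding inner_moment using a by (intro sum.cong) auto
    also have "\<dots> = - (\<Sum>l\<in>{1..<k}. b l * \<Psi> l s) / b k"
      by (simp add: sum_divide_distrib sum_negf)
    also have "\<dots> = ?f s"
      using eq[OF that] \<open>b k \<noteq> 0\<close> by (simp add: field_simps)
    finally show ?thesis by simp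
  qed
  then show thesis by (rule that)
qed

definition in_span :: "(real \<Rightarrow> real) \<Rightarrow> bool" where
  "in_span f \<longleftrightarrow> (\<exists>a0 a. \<forall>s\<in>c ` X. f s = a0 + a \<bullet> moment s)"

lemma in_span_add: "in_span f \<Longrightarrow> in_span g \<Longrightarrow> in_span (\<lambda>s. f s + g s)"
  unfolding in_span_def
proof (elim exE)
  fix a0 a b0 b assume "\<forall>s\<in>c ` X. f s = a0 + a \<bullet> moment s" "\<forall>s\<in>c ` X. g s = b0 + b \<bullet> moment s"
  then show "\<exists>a0 a. \<forall>s\<in>c ` X. f s + g s = a0 + a \<bullet> moment s"
    by (intro exI[of _ "a0 + b0"] exI[of _ "a + b"]) (simp add: inner_add_left)
qed

lemma in_span_cmult: "in_span f \<Longrightarrow> in_span (\<lambda>s. r * f s)"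
  unfolding in_span_def
proof (elim exE)
  fix a0 a assume "\<forall>s\<in>c ` X. f s = a0 + a \<bullet> moment s"
  then show "\<exists>a0 a. \<forall>s\<in>c ` X. r * f s = a0 + a \<bullet> moment s"
    by (intro exI[of _ "r * a0"] exI[of _ "r *\<^sub>R a"]) (simp add: algebra_simps)
qed

lemma in_span_sum: "(\<And>i. i \<in> A \<Longrightarrow> in_span (f i)) \<Longrightarrow> in_span (\<lambda>s. \<Sum>i\<in>A. f i s)"
proof (induction A rule: infinite_finite_induct)
  case (insert x A)
  then show ?case using in_span_add[of "f x" "\<lambda>s. \<Sum>i\<in>A. f i s"] by simp
qed (simp_all add: in_span_def exI[of _ 0])

lemma entry_span: "in_span (\<lambda>s. C s $ i $ Inl j)"
  using entry_in_span[of i j] unfolding in_span_def by metis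

lemma entry_span': "in_span (\<lambda>s. C s $ Inl i $ j)"
proof -
  have "C s $ Inl i $ j = C s $ j $ Inl i" if "s \<in> c ` X" for s
    using arg_cong[OF C_sym[OF that], of "\<lambda>A. A $ j $ Inl i"] by (simp add: transpose_def)
  then show ?thesis
    using entry_span[of j i] unfolding in_span_def by simp
qed

text \<open>Outside the lower block every entry of the symmetric matrix \<open>C(s)\<close> occurs in one of the first
  columns.\<close>

lemma quadratic_form_span:
  "in_span (\<lambda>s. q \<bullet> (C s *v q) - (\<chi> j. q $ Inr j) \<bullet> (lower_block (C s) *v (\<chi> j. q $ Inr j)))"
proof -
  have sum_split: "(\<Sum>i\<in>UNIV. g i) = (\<Sum>i\<in>UNIV. g (Inl i)) + (\<Sum>i\<in>UNIV. g (Inr i))" for g :: "'p + 'q \<Rightarrow> real"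
    using sum.Plus[of "UNIV :: 'p set" "UNIV :: 'q set" g] by (simp add: comp_def)
  have expand: "v \<bullet> (A *v v) = (\<Sum>i\<in>UNIV. \<Sum>j\<in>UNIV. (v $ i * v $ j) * A $ i $ j)" for v :: "real^'n::finite" and A
    by (simp add: inner_vec_def matrix_vector_mult_def sum_distrib_left ac_simps)
  let ?low = "\<lambda>s. \<Sum>i\<in>UNIV. \<Sum>j\<in>UNIV. (q $ Inr i * q $ Inr j) * C s $ Inr i $ Inr j"
  let ?mix = "\<lambda>s. \<Sum>i\<in>UNIV. \<Sum>j\<in>UNIV. (q $ Inr i * q $ Inl j) * C s $ Inr i $ Inl j"
  let ?up = "\<lambda>s. \<Sum>i\<in>UNIV. \<Sum>j\<in>UNIV. (q $ Inl i * q $ j) * C s $ Inl i $ j"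
  have low: "(\<chi> j. q $ Inr j) \<bullet> (lower_block (C s) *v (\<chi> j. q $ Inr j)) = ?low s" for s
    by (simp add: expand lower_block_def)
  have full: "q \<bullet> (C s *v q) = ?up s + (?mix s + ?low s)" for s
  proof -
    have "q \<bullet> (C s *v q) = ?up s + (\<Sum>i\<in>UNIV. \<Sum>j\<in>UNIV. (q $ Inr i * q $ j) * C s $ Inr i $ j)"
      unfolding expand by (rule sum_split)
    also have "(\<Sum>i\<in>UNIV. \<Sum>j\<in>UNIV. (q $ Inr i * q $ j) * C s $ Inr i $ j) = ?mix s + ?low s"
      by (simp only: sum_split sum.distrib)
    finally show ?thesis .
  qed
  have eq: "(\<lambda>s. q \<bullet> (C s *v q) - (\<chi> j. q $ Inr j) \<bullet> (lower_block (C s) *v (\<chi> j. q $ Inr j))) =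
     (\<lambda>s. ?up s + ?mix s)"
    unfolding low full by (rule ext) linarith
  show ?thesis
    unfolding eq by (intro in_span_add in_span_sum in_span_cmult entry_span entry_span')
qed

subsection \<open>Designs of the class dominate designs with the same moments\<close>

text \<open>If the part of \<open>q\<close> that meets the lower block is zero, the form itself lies in the span; otherwise
  the definiteness of \<open>F\<close> gives the sign required for the interpolant to be a majorant.\<close>

lemma majorant:
  assumes "Z \<in> dom"
  obtains a0 a where "\<And>s. s \<in> c ` X \<Longrightarrow> q \<bullet> (C s *v q) \<le> a0 + a \<bullet> moment s"
    "\<And>i. i \<in> {1..m} \<Longrightarrow> q \<bullet> (C (c (pt Z i)) *v q) = a0 + a \<bullet> moment (c (pt Z i))"
proof -
  define v :: "real^'q" where "v = (\<chi> j. q $ Inr j)"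
  let ?B = "\<lambda>A :: real^'q^'q. v \<bullet> (A *v v)"
  have B: "bounded_linear ?B"
    using linear_quadratic_form linear_conv_bounded_linear by blast
  obtain b0 b where b: "\<And>s. s \<in> c ` X \<Longrightarrow> q \<bullet> (C s *v q) = b0 + b \<bullet> moment s + ?B (lower_block (C s))"
    using quadratic_form_span[of q] unfolding in_span_def v_def[symmetric] by (force simp: algebra_simps)
  have pts: "c (pt Z i) \<in> c ` X" if "i \<in> {1..m}" for i
    using domD(2)[OF assms that] by blast
  show thesis
  proof (cases "v = 0")
    case True
    then show thesis
      using that[of b0 b] b pts by simp
  next
    case False
    define y where "y s = ?B (lower_block (C s))" for s
    define g where "g t s = ?B (H t s)" for t :: nat and s
    have y: "(y has_real_derivative g 1 s) (at s within c ` X)" if "s \<in> c ` X" for s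
      using bounded_linear.has_vector_derivative[OF B, of "\<lambda>s. lower_block (C s)" "H 1 s"] chain that
      unfolding derivative_chain_def y_def g_def has_real_derivative_iff_has_vector_derivative by blast
    have g: "((\<lambda>u. g (t - 1) u / h (t - 1) (t - 1) u) has_real_derivative g t s) (at s within c ` X)"
      if "t \<in> {2..k}" "s \<in> c ` X" for t s
    proof -
      have "((\<lambda>u. ?B (H (t - 1) u /\<^sub>R h (t - 1) (t - 1) u)) has_vector_derivative ?B (H t s)) (at s within c ` X)"
        using chain that unfolding derivative_chain_def
        by (intro bounded_linear.has_vector_derivative[OF B]) blast
      then show ?thesis
        unfolding has_real_derivative_iff_has_vector_derivative g_def
          linear_scale[OF linear_quadratic_form] by (simp add: divide_inverse_commute)
    qed
    have top: "0 < (if hi then 1 else - 1) * ((\<Prod>l\<in>{1..<k}. h l l s) * g k s)" if "s \<in> c ` X" for s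
    proof -
      have "?B (F_matrix k h H s) = (\<Prod>l\<in>{1..<k}. h l l s) * g k s"
        by (simp add: F_matrix_def g_def linear_scale[OF linear_quadratic_form])
      moreover have "?B (- F_matrix k h H s) = - ?B (F_matrix k h H s)"
        by (rule linear_neg[OF linear_quadratic_form])
      ultimately show ?thesis
        using F_definite[OF that] False by (auto simp: PD_def split: if_splits)
    qed
    obtain a0 a where a: "\<And>s. s \<in> c ` X \<Longrightarrow> y s \<le> a0 + a \<bullet> moment s"
        "\<And>i. i \<in> {1..m} \<Longrightarrow> y ((c \<circ> pt Z) i) = a0 + a \<bullet> moment ((c \<circ> pt Z) i)"
      using top_majorant[OF saturated_dom[OF assms] e_bij[OF assms] y g top] by blast
    show thesis
    proof (rule that[of "b0 + a0" "b + a"])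
      show "q \<bullet> (C s *v q) \<le> b0 + a0 + (b + a) \<bullet> moment s" if "s \<in> c ` X" for s
        using a(1)[OF that] b[OF that] by (simp add: y_def inner_add_left)
      show "q \<bullet> (C (c (pt Z i)) *v q) = b0 + a0 + (b + a) \<bullet> moment (c (pt Z i))" if "i \<in> {1..m}" for i
        using a(2)[OF that] b[OF pts[OF that]] by (simp add: y_def inner_add_left)
    qed
  qed
qed

lemma mean_inner_moment: "design_mean (\<lambda>x. a \<bullet> moment (c x)) \<zeta> = a \<bullet> design_mean (moment \<circ> c) \<zeta>"
  using design_mean_linear[OF bounded_linear.linear[OF bounded_linear_inner_right[of a]], of "moment \<circ> c" \<zeta>]
  by simp

text \<open>Integrating the majorant of \<open>q \<bullet> C(s) q\<close>: it lies above the form everywhere and agrees with it at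
  the design points of \<open>Z\<close>, while its own integral depends on the moments only.\<close>

lemma domination:
  assumes Z: "Z \<in> dom" and \<xi>: "\<xi> \<in> designs X"
    and same_moments: "design_mean (moment \<circ> c) \<xi> = design_mean (moment \<circ> c) (dsgn Z)"
  shows "loewner_le (info_matrix M \<xi>) (info_matrix M (dsgn Z))"
proof (rule loewner_leI)
  show "info_matrix M \<xi> \<in> NND" "info_matrix M (dsgn Z) \<in> NND"
    using info_matrix_NND[OF \<xi>, of M] info_matrix_NND[OF domD(5)[OF Z], of M] M_NND by blast+
  fix v
  define q where "q = transpose P *v v"
  have form: "v \<bullet> (info_matrix M \<zeta> *v v) = design_mean (\<lambda>x. q \<bullet> (C (c x) *v q)) \<zeta>"
    if "\<zeta> \<in> designs X" for \<zeta>
  proof -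
    have "v \<bullet> (M x *v v) = q \<bullet> (C (c x) *v q)" if "x \<in> X" for x
      unfolding M_eq[OF that] q_def
      by (simp add: dot_lmul_matrix matrix_vector_mul_assoc[symmetric] matrix_mul_assoc[symmetric] del: transpose_matrix_vector)
        (simp add: dot_lmul_matrix)
    then have "design_mean (\<lambda>x. v \<bullet> (M x *v v)) \<zeta> = design_mean (\<lambda>x. q \<bullet> (C (c x) *v q)) \<zeta>"
      using that by (intro design_mean_cong)
    then show ?thesis
      unfolding info_matrix_eq_mean design_mean_linear[OF linear_quadratic_form] .
  qed
  obtain a0 a where a: "\<And>s. s \<in> c ` X \<Longrightarrow> q \<bullet> (C s *v q) \<le> a0 + a \<bullet> moment s"
    "\<And>i. i \<in> {1..m} \<Longrightarrow> q \<bullet> (C (c (pt Z i)) *v q) = a0 + a \<bullet> moment (c (pt Z i))"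
    using majorant[OF Z] by blast
  have lin: "design_mean (\<lambda>x. a0 + a \<bullet> moment (c x)) \<zeta> = a0 + a \<bullet> design_mean (moment \<circ> c) \<zeta>"
    if "\<zeta> \<in> designs X" for \<zeta>
    by (simp add: design_mean_add design_mean_const[OF that] mean_inner_moment)
  have "v \<bullet> (info_matrix M \<xi> *v v) \<le> design_mean (\<lambda>x. a0 + a \<bullet> moment (c x)) \<xi>"
    unfolding form[OF \<xi>] using a(1) by (intro design_mean_mono[OF \<xi>]) auto
  also have "\<dots> = design_mean (\<lambda>x. a0 + a \<bullet> moment (c x)) (dsgn Z)"
    unfolding lin[OF \<xi>] lin[OF domD(5)[OF Z]] same_moments ..
  also have "\<dots> = design_mean (\<lambda>x. q \<bullet> (C (c x) *v q)) (dsgn Z)"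
    unfolding design_mean_design_of using a(2) by (intro sum.cong) auto
  also have "\<dots> = v \<bullet> (info_matrix M (dsgn Z) *v v)"
    unfolding form[OF domD(5)[OF Z]] ..
  finally show "v \<bullet> (info_matrix M \<xi> *v v) \<le> v \<bullet> (info_matrix M (dsgn Z) *v v)" .
qed

subsection \<open>Moving the design parameter\<close>

text \<open>The velocities of the design points and weights along the line \<open>Z + t D\<close>, including those that are not
  coordinates: fixed points do not move, and the first weight compensates the others.\<close>

definition pt_dir :: "real^'z \<Rightarrow> nat \<Rightarrow> real" where
  "pt_dir D i = (if i \<in> nonfixed L U m Fix then D $ e (Inl i) else 0)"

definition wt_dir :: "real^'z \<Rightarrow> nat \<Rightarrow> real" where
  "wt_dir D i = (if i = 1 then - (\<Sum>j=2..m. D $ e (Inr j)) else D $ e (Inr i))"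

lemma pt_along: "i \<in> {1..m} \<Longrightarrow> pt (Z + t *\<^sub>R D) i = pt Z i + t * pt_dir D i"
  by (auto simp: point_of_def pt_dir_def nonfixed_def)

lemma wt_along: "wt (Z + t *\<^sub>R D) i = wt Z i + t * wt_dir D i"
  by (auto simp: weight_of_def wt_dir_def sum.distrib sum_distrib_left algebra_simps)

lemma eventually_affine_less:
  fixes a b u v :: real
  assumes "a < b"
  shows "\<forall>\<^sub>F t in at_right 0. a + t * u < b + t * v"
proof -
  have "((\<lambda>t. a + t * u) \<longlongrightarrow> a + 0 * u) (at_right 0)" "((\<lambda>t. b + t * v) \<longlongrightarrow> b + 0 * v) (at_right 0)"
    by (intro tendsto_intros)+
  then show ?thesis
    using order_tendstoD(1)[OF tendsto_diff[of "\<lambda>t. b + t * v" _ _ "\<lambda>t. a + t * u"], of "b + 0 * v" _ "a + 0 * u" 0] assms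
    by simp
qed

text \<open>Order of the points and positivity of the weights are open conditions. Only a point on the boundary of
  the design space restricts the direction.\<close>

lemma eventually_feasible:
  assumes Z: "Z \<in> dom" and pos: "\<And>i. i \<in> {1..m} \<Longrightarrow> 0 < wt Z i"
    and inward: "\<And>i. i \<in> nonfixed L U m Fix \<Longrightarrow>
      (ereal (pt Z i) = L \<longrightarrow> 0 \<le> pt_dir D i) \<and> (ereal (pt Z i) = U \<longrightarrow> pt_dir D i \<le> 0)"
  shows "\<forall>\<^sub>F t in at_right 0. Z + t *\<^sub>R D \<in> dom"
proof -
  let ?p = "\<lambda>t i. pt Z i + t * pt_dir D i"
  have "\<forall>\<^sub>F t in at_right 0. \<forall>i\<in>{1..m}. \<forall>j\<in>{i<..m}. ?p t i < ?p t j"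
    by (intro eventually_ball_finite ballI finite_atLeastAtMost finite_greaterThanAtMost eventually_affine_less
        strict_mono_onD[OF domD(1)[OF Z]]) auto
  moreover have "\<forall>\<^sub>F t in at_right 0. \<forall>i\<in>{1..m}. L \<le> ereal (?p t i) \<and> ereal (?p t i) \<le> U"
  proof (intro eventually_ball_finite ballI finite_atLeastAtMost)
    fix i assume i: "i \<in> {1..m}"
    have bounds: "L \<le> ereal (pt Z i)" "ereal (pt Z i) \<le> U"
      using domD(2)[OF Z i] by (simp_all add: design_space_def)
    have inw: "ereal (pt Z i) = L \<Longrightarrow> 0 \<le> pt_dir D i" "ereal (pt Z i) = U \<Longrightarrow> pt_dir D i \<le> 0"
      using inward[of i] by (auto simp: pt_dir_def)
    have "\<forall>\<^sub>F t in at_right 0. L \<le> ereal (?p t i)"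
    proof (cases "ereal (pt Z i) = L")
      case True
      have "\<forall>\<^sub>F t in at_right (0 :: real). 0 < t"
        by (simp add: eventually_at_right_less)
      then show ?thesis
      proof eventually_elim
        case (elim t)
        then have "ereal (pt Z i) \<le> ereal (?p t i)"
          using inw(1)[OF True] by simp
        with bounds(1) show ?case by (rule order_trans)
      qed
    next
      case False
      then obtain r where r: "L < ereal r" "r < pt Z i"
        using bounds ereal_dense2[of L "ereal (pt Z i)"] by (auto simp: order_less_le)
      show ?thesis
        using eventually_affine_less[OF r(2), of 0 "pt_dir D i"]
      proof eventually_elim
        case (elim t)
        then have "ereal r < ereal (?p t i)" by simp
        with r(1) show ?case by (meson less_imp_le less_trans)
      qed
    qed
    moreover have "\<forall>\<^sub>F t in at_right 0. ereal (?p t i) \<le> U"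
    proof (cases "ereal (pt Z i) = U")
      case True
      have "\<forall>\<^sub>F t in at_right (0 :: real). 0 < t"
        by (simp add: eventually_at_right_less)
      then show ?thesis
      proof eventually_elim
        case (elim t)
        then have "ereal (?p t i) \<le> ereal (pt Z i)"
          using inw(2)[OF True] by (simp add: mult_nonneg_nonpos)
        then show ?case using bounds(2) by (rule order_trans)
      qed
    next
      case False
      then obtain r where r: "ereal r < U" "pt Z i < r"
        using bounds ereal_dense2[of "ereal (pt Z i)" U] by (auto simp: order_less_le)
      show ?thesis
        using eventually_affine_less[OF r(2), of "pt_dir D i" 0]
      proof eventually_elim
        case (elim t)
        then have "ereal (?p t i) < ereal r" by simp
        with r(1) show ?case by (meson less_imp_le less_trans)
      qed
    qed
    ultimately show "\<forall>\<^sub>F t in at_right 0. L \<le> ereal (?p t i) \<and> ereal (?p t i) \<le> U"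
      by (rule eventually_conj)
  qed
  moreover have "\<forall>\<^sub>F t in at_right 0. \<forall>i\<in>{1..m}. 0 + t * 0 < wt Z i + t * wt_dir D i"
    using pos by (intro eventually_ball_finite ballI finite_atLeastAtMost eventually_affine_less) auto
  ultimately show ?thesis
  proof eventually_elim
    case (elim t)
    have pt: "pt (Z + t *\<^sub>R D) i = ?p t i" if "i \<in> {1..m}" for i
      by (rule pt_along[OF that])
    have "Fix \<subseteq> ereal ` pt (Z + t *\<^sub>R D) ` {1..m}"
    proof
      fix v assume "v \<in> Fix"
      then obtain i where i: "i \<in> {1..m}" "v = ereal (pt Z i)"
        using domD(4)[OF Z] by blast
      then have "i \<notin> nonfixed L U m Fix"
        using nonfixed_iff[OF Z i(1)] \<open>v \<in> Fix\<close> by simp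
      then have "v = ereal (pt (Z + t *\<^sub>R D) i)"
        using pt[OF i(1)] i(2) by (simp add: pt_dir_def)
      with i(1) show "v \<in> ereal ` pt (Z + t *\<^sub>R D) ` {1..m}" by blast
    qed
    moreover have "strict_mono_on {1..m} (pt (Z + t *\<^sub>R D))"
      using elim(1) by (intro strict_mono_onI) (simp add: pt)
    moreover have "\<forall>i\<in>{1..m}. pt (Z + t *\<^sub>R D) i \<in> X \<and> 0 \<le> wt (Z + t *\<^sub>R D) i"
    proof
      fix i assume i: "i \<in> {1..m}"
      have "0 < wt (Z + t *\<^sub>R D) i"
        unfolding wt_along using elim(3) i by simp
      then show "pt (Z + t *\<^sub>R D) i \<in> X \<and> 0 \<le> wt (Z + t *\<^sub>R D) i"
        unfolding pt[OF i] design_space_def using elim(2) i by simp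
    qed
    ultimately show ?case
      using m_ge by (simp add: Z_domain_iff)
  qed
qed

lemma c'_sign:
  assumes "x \<in> X"
  shows "strict_mono_on X c \<Longrightarrow> 0 \<le> c' x" "strict_antimono_on X c \<Longrightarrow> c' x \<le> 0"
proof -
  have "infinite (X - {x})"
    using infinite_design_space[OF nontrivial] by simp
  then obtain y where y: "y \<in> X" "x \<noteq> y"
    by (metis Diff_iff ex_in_conv finite.emptyI insertI1)
  show "0 \<le> c' x" if "strict_mono_on X c"
    using increasing_derivative_nonneg[OF is_interval_design_space assms y c_deriv[OF assms]]
      monotone_onD[OF that] by blast
  have "((\<lambda>x. - c x) has_real_derivative - c' x) (at x within X)"
    by (intro DERIV_minus c_deriv assms)
  then show "c' x \<le> 0" if "strict_antimono_on X c"
    using increasing_derivative_nonneg[OF is_interval_design_space assms y, of "\<lambda>x. - c x" "- c' x"]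
      monotone_onD[OF that] by simp
qed

text \<open>Whether \<open>c\<close> increases or decreases, moving inwards from an endpoint of the design space (direction \<open>\<sigma>\<close>)
  moves the transformed point inwards from an endpoint of \<open>c ` X\<close>.\<close>

lemma end_sign:
  assumes x: "x \<in> X" and \<sigma>: "ereal x = L \<and> \<sigma> = 1 \<or> ereal x = U \<and> \<sigma> = - 1"
  shows "(\<forall>t\<in>c ` X. c x \<le> t) \<and> 0 \<le> \<sigma> * c' x \<or> (\<forall>t\<in>c ` X. t \<le> c x) \<and> \<sigma> * c' x \<le> 0"
proof -
  note ends = design_space_least_iff[OF nontrivial x] design_space_greatest_iff[OF nontrivial x]
  note ext = extremes_of_monotone_image[OF x, of c]
  from c_mono show ?thesis
  proof
    assume mono: "strict_mono_on X c"
    then show ?thesis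
      using \<sigma> c'_sign(1)[OF x mono] ends ext(1,2)[OF mono] by auto
  next
    assume anti: "strict_antimono_on X c"
    then show ?thesis
      using \<sigma> c'_sign(2)[OF x anti] ends ext(3,4)[OF anti] by auto
  qed
qed

text \<open>Solvability is the invertibility of the transposed Jacobian. For the inward property at a boundary
  point, pair the equation with the coefficient vector \<open>a\<close> of the function that the Jacobian maps to the
  unit vector belonging to this point: this function vanishes at all design points, is nonnegative
  on the interval by \<open>span_nonneg\<close>, and its mean under \<open>\<xi>\<close> is the velocity of the point.\<close>

lemma moment_direction:
  assumes Z: "Z \<in> dom" and pos: "\<And>i. i \<in> {1..m} \<Longrightarrow> 0 < wt Z i" and \<xi>: "\<xi> \<in> designs X"
  obtains D where
    "(\<Sum>i\<in>{1..m}. wt Z i *\<^sub>R ((pt_dir D i * c' (pt Z i)) *\<^sub>R moment_deriv (c (pt Z i))) +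
        wt_dir D i *\<^sub>R moment (c (pt Z i))) =
      design_mean (moment \<circ> c) \<xi> - design_mean (moment \<circ> c) (dsgn Z)"
    "\<And>i. i \<in> nonfixed L U m Fix \<Longrightarrow>
      (ereal (pt Z i) = L \<longrightarrow> 0 \<le> pt_dir D i) \<and> (ereal (pt Z i) = U \<longrightarrow> pt_dir D i \<le> 0)"
proof -
  define N where "N = nonfixed L U m Fix"
  define p where "p = c \<circ> pt Z"
  define \<kappa> where "\<kappa> i = wt Z i * c' (pt Z i)" for i
  define d where "d = design_mean (moment \<circ> c) \<xi> - design_mean (moment \<circ> c) (dsgn Z)"
  have sat: "saturated p" and N: "nonfixed_indices p = N" and bij: "bij_betw e (N <+> {2..m}) UNIV"
    using saturated_dom[OF Z] nonfixed_indices_dom[OF Z] e_bij[OF Z] by (simp_all add: p_def N_def)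
  have bij': "bij_betw e (nonfixed_indices p <+> {2..m}) UNIV"
    unfolding N by (fact bij)
  have N_sub: "N \<subseteq> {1..m}"
    by (auto simp: N_def nonfixed_def)
  have c'_nz: "c' (pt Z i) \<noteq> 0" if "i \<in> N" for i
    using c'_nonzero[OF domD(2)[OF Z]] nonfixed_iff[OF Z] that N_sub unfolding N_def by blast
  have \<kappa>: "\<kappa> i \<noteq> 0" if "i \<in> nonfixed_indices p" for i
    using c'_nz[of i] pos[of i] that N N_sub unfolding \<kappa>_def by force
  let ?J = "design_jacobian p \<kappa> e"
  obtain B where "transpose ?J ** B = mat 1"
    using transpose_invertible[OF invertible_design_jacobian[OF sat bij', of \<kappa>]] \<kappa>
    unfolding invertible_def by blast
  then have "transpose ?J *v (B *v d) = d"
    by (simp add: matrix_vector_mul_assoc del: transpose_matrix_vector)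
  moreover define D where "D = B *v d"
  ultimately have "D v* ?J = d"
    by simp
  then have adj: "D \<bullet> (?J *v a) = a \<bullet> d" for a
    using dot_lmul_matrix[of D ?J a] by (simp add: inner_commute)
  show thesis
  proof (rule that[of D])
    let ?V = "\<Sum>i\<in>{1..m}. wt Z i *\<^sub>R ((pt_dir D i * c' (pt Z i)) *\<^sub>R moment_deriv (c (pt Z i))) +
        wt_dir D i *\<^sub>R moment (c (pt Z i))"
    have dot: "a \<bullet> ?V = a \<bullet> d" for a
    proof -
      have "a \<bullet> ?V = (\<Sum>i\<in>{1..m}. pt_dir D i * \<kappa> i * (a \<bullet> moment_deriv (p i))) +
          (\<Sum>i\<in>{1..m}. wt_dir D i * (a \<bullet> moment (p i)))"
        by (simp add: inner_sum_right inner_add_right sum.distrib \<kappa>_def p_def ac_simps)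
      also have "(\<Sum>i\<in>{1..m}. pt_dir D i * \<kappa> i * (a \<bullet> moment_deriv (p i))) =
          (\<Sum>i\<in>N. D $ e (Inl i) * (\<kappa> i * (a \<bullet> moment_deriv (p i))))"
        using N_sub by (intro sum.mono_neutral_cong_right) (auto simp: pt_dir_def N_def)
      also have "(\<Sum>i\<in>{1..m}. wt_dir D i * (a \<bullet> moment (p i))) =
          (\<Sum>i\<in>{2..m}. D $ e (Inr i) * (a \<bullet> moment (p i) - a \<bullet> moment (p 1)))"
      proof -
        have "{1..m} = insert 1 {2..m}" using m_ge by auto
        then have "(\<Sum>i\<in>{1..m}. wt_dir D i * (a \<bullet> moment (p i))) =
            wt_dir D 1 * (a \<bullet> moment (p 1)) + (\<Sum>i\<in>{2..m}. wt_dir D i * (a \<bullet> moment (p i)))"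
          by simp
        also have "(\<Sum>i\<in>{2..m}. wt_dir D i * (a \<bullet> moment (p i))) =
            (\<Sum>i\<in>{2..m}. D $ e (Inr i) * (a \<bullet> moment (p i)))"
          by (intro sum.cong) (auto simp: wt_dir_def)
        finally show ?thesis
          by (simp add: wt_dir_def right_diff_distrib sum_subtractf sum_distrib_right)
      qed
      also have "(\<Sum>i\<in>N. D $ e (Inl i) * (\<kappa> i * (a \<bullet> moment_deriv (p i)))) +
          (\<Sum>i\<in>{2..m}. D $ e (Inr i) * (a \<bullet> moment (p i) - a \<bullet> moment (p 1))) =
          (\<Sum>i\<in>N. D $ e (Inl i) * (?J $ e (Inl i) \<bullet> a)) + (\<Sum>i\<in>{2..m}. D $ e (Inr i) * (?J $ e (Inr i) \<bullet> a))"
        using design_jacobian_rows[OF sat bij', unfolded N]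
        by (intro arg_cong2[where f = "(+)"] sum.cong) (simp_all add: inner_diff_right inner_commute[of _ a])
      also have "\<dots> = (\<Sum>j\<in>N <+> {2..m}. D $ e j * (?J $ e j \<bullet> a))"
        using finite_subset[OF N_sub] by (simp add: sum.Plus comp_def)
      also have "\<dots> = D \<bullet> (?J *v a)"
        using sum.reindex_bij_betw[OF bij, of "\<lambda>z. D $ z * (?J $ z \<bullet> a)"]
        by (simp add: inner_vec_def[of D] matrix_vector_mul_component)
      finally show ?thesis
        using adj by simp
    qed
    show "?V = design_mean (moment \<circ> c) \<xi> - design_mean (moment \<circ> c) (dsgn Z)"
      unfolding d_def[symmetric] by (rule iffD1[OF vector_eq_ldot, OF allI[OF dot]])
  next
    fix i assume "i \<in> nonfixed L U m Fix"
    then have i: "i \<in> N" "i \<in> {1..m}"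
      using N_sub by (auto simp: N_def)
    have "0 \<le> \<sigma> * D $ e (Inl i)"
      if \<sigma>: "ereal (pt Z i) = L \<and> \<sigma> = 1 \<or> ereal (pt Z i) = U \<and> \<sigma> = - 1" for \<sigma>
    proof -
      obtain a where a: "\<And>j. j \<in> N \<Longrightarrow> \<kappa> j * (a \<bullet> moment_deriv (p j)) = axis (e (Inl i)) \<sigma> $ e (Inl j)"
        "\<And>j. j \<in> {2..m} \<Longrightarrow> a \<bullet> moment (p j) - a \<bullet> moment (p 1) = axis (e (Inl i)) \<sigma> $ e (Inr j)"
        "?J *v a = axis (e (Inl i)) \<sigma>"
        using interpolation[OF sat bij', of \<kappa> "axis (e (Inl i)) \<sigma>"] \<kappa> unfolding N by blast
      have e_inj: "e x = e y \<longleftrightarrow> x = y" if "x \<in> N <+> {2..m}" "y \<in> N <+> {2..m}" for x y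
        by (rule inj_on_eq_iff[OF bij_betw_imp_inj_on[OF bij] that])
      have same: "a \<bullet> moment (p j) = a \<bullet> moment (p 1)" if "j \<in> {1..m}" for j
      proof (cases "j = 1")
        case False
        with that have j: "j \<in> {2..m}" by simp
        then have "e (Inr j) \<noteq> e (Inl i)"
          using e_inj i(1) by (simp add: InlI InrI)
        then show ?thesis
          using a(2)[OF j] by (simp add: axis_def)
      qed simp
      have crit: "a \<bullet> moment_deriv (p j) = 0" if "j \<in> N" "j \<noteq> i" for j
      proof -
        have "e (Inl j) \<noteq> e (Inl i)"
          using e_inj that i(1) by (simp add: InlI)
        then show ?thesis
          using a(1)[OF that(1)] \<kappa>[of j] that(1) N by (simp add: axis_def)
      qed
      define u' where "u' = a \<bullet> moment_deriv (p i)"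
      have "wt Z i * c' (pt Z i) * u' = \<sigma>"
        using a(1)[OF i(1)] by (simp add: \<kappa>_def u'_def axis_def)
      then have "wt Z i * (c' (pt Z i))\<^sup>2 * u' = \<sigma> * c' (pt Z i)"
        by (simp add: power2_eq_square algebra_simps)
      moreover have "0 < wt Z i * (c' (pt Z i))\<^sup>2"
        using pos[OF i(2)] c'_nz[OF i(1)] by simp
      ultimately have u': "0 \<le> \<sigma> * c' (pt Z i) \<Longrightarrow> 0 \<le> u'" "\<sigma> * c' (pt Z i) \<le> 0 \<Longrightarrow> u' \<le> 0"
        by (metis zero_le_mult_iff not_less, metis mult_le_0_iff not_less)
      have nonneg: "0 \<le> - (a \<bullet> moment (p 1)) + (\<Sum>l\<in>{1..<k}. a $ \<pi> l * \<Psi> l s)" if "s \<in> c ` X" for s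
      proof (rule span_nonneg[OF sat _ _ that])
        show "- (a \<bullet> moment (p 1)) + (\<Sum>l\<in>{1..<k}. a $ \<pi> l * \<Psi> l (p j)) = 0" if "j \<in> {1..m}" for j
          using same[OF that] unfolding inner_moment[symmetric] by simp
        fix j v assume j: "j \<in> {1..m}" "p j \<notin> fixed_ends (c ` X) lo hi"
          and v: "v = (\<Sum>l\<in>{1..<k}. a $ \<pi> l * h l 1 (p j))"
        have "j \<in> N"
          using j unfolding N[symmetric] nonfixed_indices_def by blast
        have v: "v = a \<bullet> moment_deriv (p j)"
          unfolding v inner_moment_deriv ..
        show "v = 0 \<or> (\<forall>t\<in>c ` X. p j \<le> t) \<and> 0 \<le> v \<or> (\<forall>t\<in>c ` X. t \<le> p j) \<and> v \<le> 0"
        proof (cases "j = i")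
          case True
          then show ?thesis
            using end_sign[OF domD(2)[OF Z i(2)] \<sigma>] u' v by (auto simp: u'_def p_def)
        next
          case False
          then show ?thesis
            using crit[OF \<open>j \<in> N\<close>] v by simp
        qed
      qed
      have "a \<bullet> moment (p 1) = design_mean (\<lambda>x. a \<bullet> moment (p 1)) \<xi>"
        using design_mean_const[OF \<xi>] by simp
      also have "\<dots> \<le> design_mean (\<lambda>x. a \<bullet> moment (c x)) \<xi>"
      proof (rule design_mean_mono[OF \<xi>])
        show "a \<bullet> moment (p 1) \<le> a \<bullet> moment (c x)" if "x \<in> X" for x
          using nonneg[OF imageI[OF that]] unfolding inner_moment[symmetric] by simp
      qed
      finally have "a \<bullet> moment (p 1) \<le> a \<bullet> design_mean (moment \<circ> c) \<xi>"
        by (simp add: mean_inner_moment)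
      moreover have "design_mean (\<lambda>x. a \<bullet> moment (c x)) (dsgn Z) = design_mean (\<lambda>x. a \<bullet> moment (p 1)) (dsgn Z)"
        unfolding design_mean_design_of
      proof (rule sum.cong[OF refl])
        fix j assume "j \<in> {1..m}"
        from same[OF this]
        show "wt Z j *\<^sub>R (a \<bullet> moment (c (pt Z j))) = wt Z j *\<^sub>R (a \<bullet> moment (p 1))"
          by (simp only: p_def comp_def)
      qed
      then have "a \<bullet> moment (p 1) = a \<bullet> design_mean (moment \<circ> c) (dsgn Z)"
        using design_mean_const[OF domD(5)[OF Z]] by (simp add: mean_inner_moment)
      ultimately have "0 \<le> a \<bullet> d"
        by (simp add: d_def inner_diff_right)
      also have "a \<bullet> d = \<sigma> * D $ e (Inl i)"
        using adj[of a] unfolding a(3) by (simp add: inner_axis mult.commute)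
      finally show ?thesis .
    qed
    from this[of 1] this[of "- 1"] i(1)
    show "(ereal (pt Z i) = L \<longrightarrow> 0 \<le> pt_dir D i) \<and> (ereal (pt Z i) = U \<longrightarrow> pt_dir D i \<le> 0)"
      by (auto simp: pt_dir_def N_def)
  qed
qed

lemma moment_derivative_along:
  assumes dom: "\<And>t. t \<in> {0..t0} \<Longrightarrow> Z + t *\<^sub>R D \<in> dom" and "0 < t0"
  shows "((\<lambda>t. design_mean (moment \<circ> c) (dsgn (Z + t *\<^sub>R D))) has_vector_derivative
      (\<Sum>i\<in>{1..m}. wt Z i *\<^sub>R ((pt_dir D i * c' (pt Z i)) *\<^sub>R moment_deriv (c (pt Z i))) +
        wt_dir D i *\<^sub>R moment (c (pt Z i)))) (at 0 within {0..t0})"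
proof -
  have "((\<lambda>t. (wt Z i + t * wt_dir D i) *\<^sub>R moment (c (pt Z i + t * pt_dir D i))) has_vector_derivative
      wt Z i *\<^sub>R ((pt_dir D i * c' (pt Z i)) *\<^sub>R moment_deriv (c (pt Z i))) +
        wt_dir D i *\<^sub>R moment (c (pt Z i))) (at 0 within {0..t0})" if i: "i \<in> {1..m}" for i
  proof -
    let ?x = "\<lambda>t. pt Z i + t * pt_dir D i"
    have x: "?x t \<in> X" if "t \<in> {0..t0}" for t
      using domD(2)[OF dom[OF that] i] by (simp add: pt_along[OF i])
    have x0: "pt Z i \<in> X"
      using x[of 0] \<open>0 < t0\<close> by simp
    have "(?x has_real_derivative pt_dir D i) (at 0 within {0..t0})"
      by (auto intro!: derivative_eq_intros)
    moreover have "(c has_real_derivative c' (pt Z i)) (at (?x 0) within ?x ` {0..t0})"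
    proof -
      have "?x ` {0..t0} \<subseteq> X"
        using x by blast
      from has_field_derivative_subset[OF c_deriv[OF x0] this] show ?thesis by simp
    qed
    ultimately have "((c \<circ> ?x) has_real_derivative c' (pt Z i) * pt_dir D i) (at 0 within {0..t0})"
      by (intro DERIV_image_chain)
    then have cx: "((c \<circ> ?x) has_real_derivative pt_dir D i * c' (pt Z i)) (at 0 within {0..t0})"
      by (simp only: mult.commute[of "pt_dir D i"])
    have "(moment has_vector_derivative moment_deriv (c (pt Z i))) (at ((c \<circ> ?x) 0) within (c \<circ> ?x) ` {0..t0})"
    proof -
      have "(c \<circ> ?x) ` {0..t0} \<subseteq> c ` X"
        using x by auto
      from has_vector_derivative_within_subset[OF moment_has_derivative[OF imageI[OF x0]] this]
      show ?thesis by simp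
    qed
    with cx have moments: "((moment \<circ> (c \<circ> ?x)) has_vector_derivative
        (pt_dir D i * c' (pt Z i)) *\<^sub>R moment_deriv (c (pt Z i))) (at 0 within {0..t0})"
      unfolding has_real_derivative_iff_has_vector_derivative by (rule vector_diff_chain_within)
    have weights: "((\<lambda>t. wt Z i + t * wt_dir D i) has_real_derivative wt_dir D i) (at 0 within {0..t0})"
      by (auto intro!: derivative_eq_intros)
    show ?thesis
      using has_vector_derivative_scaleR[OF weights moments] by (simp add: comp_def)
  qed
  then have "((\<lambda>t. \<Sum>i\<in>{1..m}. (wt Z i + t * wt_dir D i) *\<^sub>R moment (c (pt Z i + t * pt_dir D i))) has_vector_derivative
      (\<Sum>i\<in>{1..m}. wt Z i *\<^sub>R ((pt_dir D i * c' (pt Z i)) *\<^sub>R moment_deriv (c (pt Z i))) +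
        wt_dir D i *\<^sub>R moment (c (pt Z i)))) (at 0 within {0..t0})"
    by (intro has_vector_derivative_sum)
  moreover have "design_mean (moment \<circ> c) (dsgn (Z + t *\<^sub>R D)) =
      (\<Sum>i\<in>{1..m}. (wt Z i + t * wt_dir D i) *\<^sub>R moment (c (pt Z i + t * pt_dir D i)))" for t
    unfolding design_mean_design_of by (intro sum.cong) (simp_all add: pt_along wt_along)
  ultimately show ?thesis by simp
qed

text \<open>A convex set without interior lies in a hyperplane, which the curve of moments does not.\<close>

lemma interior_of_moments: "interior (design_mean (moment \<circ> c) ` designs X) \<noteq> {}"
proof
  assume empty: "interior (design_mean (moment \<circ> c) ` designs X) = {}"
  obtain a b where "a \<noteq> 0" and ab: "design_mean (moment \<circ> c) ` designs X \<subseteq> {x. a \<bullet> x = b}"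
    using empty_interior_subset_hyperplane[OF convex_design_means empty] by blast
  have "a \<bullet> moment s = b" if s: "s \<in> c ` X" for s
  proof -
    obtain x where x: "x \<in> X" "s = c x"
      using s by blast
    have "moment s \<in> design_mean (moment \<circ> c) ` designs X"
      using mean_of_point[OF x(1), of "moment \<circ> c"] x(2) by simp
    with ab show ?thesis by blast
  qed
  with moment_not_in_hyperplane \<open>a \<noteq> 0\<close> show False by blast
qed

section \<open>Optimality of feasible critical points\<close>

text \<open>The argument described at the beginning. The designs \<open>\<xi>4\<close> on the perturbed segment have exactly the
  moments of the designs on the line, so they are dominated by them. Along these designs concavity
  gives growth at the positive rate \<open>gain\<close> (nonnegativity of the criterion limits the loss
  caused by the admixture), whereas the vanishing derivative allows a rate of at most half of that.\<close>

lemma critical_point_optimal: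
  assumes nonneg: "\<And>A. A \<in> NND \<Longrightarrow> 0 \<le> \<Phi> A"
    and concave: "concave_on NND \<Phi>"
    and isotonic: "\<And>A B. A \<in> NND \<Longrightarrow> B \<in> NND \<Longrightarrow> loewner_le A B \<Longrightarrow> \<Phi> A \<le> \<Phi> B"
    and Z: "Z \<in> dom" and pos: "\<And>i. i \<in> {1..m} \<Longrightarrow> 0 < wt Z i"
    and crit: "(objective L U M \<Phi> m Fix e has_derivative (\<lambda>_. 0)) (at Z within dom)"
    and \<zeta>: "\<zeta> \<in> designs X"
  shows "\<Phi> (info_matrix M \<zeta>) \<le> \<Phi> (info_matrix M (dsgn Z))"
proof (rule ccontr)
  let ?\<mu> = "design_mean (moment \<circ> c)"
  assume "\<not> ?thesis"
  then have better: "\<Phi> (info_matrix M (dsgn Z)) < \<Phi> (info_matrix M \<zeta>)" by simp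
  define v where "v = \<Phi> (info_matrix M (dsgn Z))"
  define v1 where "v1 = \<Phi> (info_matrix M \<zeta>)"
  have NND: "info_matrix M \<xi> \<in> NND" if "\<xi> \<in> designs X" for \<xi>
    using info_matrix_NND[OF that, of M] M_NND by blast
  have v: "0 \<le> v" "v < v1"
    using nonneg[OF NND[OF domD(5)[OF Z]]] better by (simp_all add: v_def v1_def)
  \<comment> \<open>The proportion of the admixture, chosen such that half of the advantage of \<open>\<zeta>\<close> is kept.\<close>
  define \<eta> where "\<eta> = (v1 - v) / (2 * v1)"
  define gain where "gain = (v1 - v) / 2"
  have \<eta>: "0 < \<eta>" "\<eta> < 1" and gain: "0 < gain" "(1 - \<eta>) * v1 = v + gain"
    using v by (simp_all add: \<eta>_def gain_def field_simps)
  obtain \<mu>0 r where r: "0 < r" "ball \<mu>0 r \<subseteq> ?\<mu> ` designs X"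
    using interior_of_moments by (metis ex_in_conv mem_interior)
  then obtain \<xi>0 where \<xi>0: "\<xi>0 \<in> designs X" "?\<mu> \<xi>0 = \<mu>0"
    by (metis (no_types, lifting) centre_in_ball image_iff subsetD)
  have \<xi>1: "mix \<eta> \<zeta> \<xi>0 \<in> designs X"
    using mix_in_designs[OF \<zeta> \<xi>0(1)] \<eta> by simp
  define d where "d = ?\<mu> (mix \<eta> \<zeta> \<xi>0) - ?\<mu> (dsgn Z)"
  obtain D where D: "(\<Sum>i\<in>{1..m}. wt Z i *\<^sub>R ((pt_dir D i * c' (pt Z i)) *\<^sub>R moment_deriv (c (pt Z i))) +
        wt_dir D i *\<^sub>R moment (c (pt Z i))) = ?\<mu> (mix \<eta> \<zeta> \<xi>0) - ?\<mu> (dsgn Z)"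
    "\<And>i. i \<in> nonfixed L U m Fix \<Longrightarrow>
      (ereal (pt Z i) = L \<longrightarrow> 0 \<le> pt_dir D i) \<and> (ereal (pt Z i) = U \<longrightarrow> pt_dir D i \<le> 0)"
    by (rule moment_direction[OF Z _ \<xi>1]) (erule pos, rule that)
  have "\<forall>\<^sub>F t in at_right 0. Z + t *\<^sub>R D \<in> dom"
    by (rule eventually_feasible[OF Z pos D(2)])
  then obtain b where b: "0 < b" "\<And>t. 0 < t \<Longrightarrow> t < b \<Longrightarrow> Z + t *\<^sub>R D \<in> dom"
    unfolding eventually_at_right_field by auto
  define t0 where "t0 = b / 2"
  have t0: "0 < t0" and feasible: "\<And>t. t \<in> {0..t0} \<Longrightarrow> Z + t *\<^sub>R D \<in> dom"
  proof -
    show "0 < t0" using b(1) by (simp add: t0_def)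
    show "Z + t *\<^sub>R D \<in> dom" if "t \<in> {0..t0}" for t
      using that b Z by (cases "t = 0") (simp_all add: t0_def)
  qed
  have "((\<lambda>t. ?\<mu> (dsgn (Z + t *\<^sub>R D))) has_derivative (\<lambda>t. t *\<^sub>R d)) (at 0 within {0..t0})"
    using moment_derivative_along[OF feasible t0] unfolding D(1) d_def has_vector_derivative_def .
  moreover have "0 < \<eta> * r / 2" using \<eta> r(1) by simp
  ultimately obtain d1 where d1: "0 < d1" "\<And>t. t \<in> {0..t0} \<Longrightarrow> norm (t - 0) < d1 \<Longrightarrow>
      norm (?\<mu> (dsgn (Z + t *\<^sub>R D)) - ?\<mu> (dsgn (Z + 0 *\<^sub>R D)) - (t - 0) *\<^sub>R d) \<le> \<eta> * r / 2 * norm (t - 0)"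
    unfolding has_derivative_within_alt by blast
  \<comment> \<open>The summand \<open>1\<close> avoids a division by zero if \<open>D = 0\<close>.\<close>
  define \<epsilon> where "\<epsilon> = gain / (2 * (norm D + 1))"
  have "0 < \<epsilon>"
    using gain(1) by (simp add: \<epsilon>_def add_nonneg_pos)
  then obtain d2 where d2: "0 < d2" "\<And>Y. Y \<in> dom \<Longrightarrow> norm (Y - Z) < d2 \<Longrightarrow>
      norm (objective L U M \<Phi> m Fix e Y - objective L U M \<Phi> m Fix e Z - 0) \<le> \<epsilon> * norm (Y - Z)"
    using crit unfolding has_derivative_within_alt by blast
  define t where "t = min (min t0 (d1 / 2)) (min 1 (d2 / (2 * (norm D + 1))))"
  have norm_D: "0 < norm D + 1"
    by (simp add: add_nonneg_pos)
  have t: "0 < t" "t \<in> {0..t0}" "t < d1" "t \<le> 1" "t \<le> d2 / (2 * (norm D + 1))"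
    using t0 d1(1) d2(1) norm_D by (auto simp: t_def min_less_iff_disj)
  define Z' where "Z' = Z + t *\<^sub>R D"
  have Z': "Z' \<in> dom"
    using feasible[OF t(2)] by (simp add: Z'_def)
  \<comment> \<open>The first-order error of the moments, divided by \<open>t\<close>; it is passed on to the interior design.\<close>
  define \<rho> where "\<rho> = (1 / t) *\<^sub>R (?\<mu> (dsgn Z') - ?\<mu> (dsgn Z)) - d"
  have "t *\<^sub>R \<rho> = ?\<mu> (dsgn Z') - ?\<mu> (dsgn Z) - t *\<^sub>R d"
    using t(1) by (simp add: \<rho>_def algebra_simps)
  moreover have "norm \<dots> \<le> \<eta> * r / 2 * t"
    using d1(2)[OF t(2)] t(1,3) by (simp add: Z'_def)
  ultimately have "t * norm \<rho> \<le> t * (\<eta> * r / 2)"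
    using t(1) by (metis abs_of_pos mult.commute norm_scaleR)
  then have "norm \<rho> \<le> \<eta> * r / 2"
    using t(1) by simp
  also have "\<dots> < \<eta> * r"
    using \<eta>(1) r(1) by simp
  finally have "norm ((1 / \<eta>) *\<^sub>R \<rho>) < r"
    using \<eta>(1) by (simp add: field_simps)
  then have "\<mu>0 + (1 / \<eta>) *\<^sub>R \<rho> \<in> ball \<mu>0 r"
    by (simp add: dist_norm)
  then obtain \<xi>2 where \<xi>2: "\<xi>2 \<in> designs X" "?\<mu> \<xi>2 = \<mu>0 + (1 / \<eta>) *\<^sub>R \<rho>"
    using r(2) by (metis (no_types, lifting) imageE subsetD)
  define \<xi>3 where "\<xi>3 = mix \<eta> \<zeta> \<xi>2"
  define \<xi>4 where "\<xi>4 = mix t (dsgn Z) \<xi>3"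
  have designs: "\<xi>3 \<in> designs X" "\<xi>4 \<in> designs X"
    using mix_in_designs[OF \<zeta> \<xi>2(1), of \<eta>] mix_in_designs[OF domD(5)[OF Z], of \<xi>3 t] \<eta> t
    by (simp_all add: \<xi>3_def \<xi>4_def)
  have "?\<mu> \<xi>3 = ?\<mu> (mix \<eta> \<zeta> \<xi>0) + \<rho>"
    using \<eta>(1) by (simp add: \<xi>3_def design_mean_mix \<xi>2(2) \<xi>0(2) scaleR_add_right)
  then have "?\<mu> \<xi>3 = ?\<mu> (dsgn Z) + (d + \<rho>)"
    by (simp add: d_def)
  then have "?\<mu> \<xi>4 = ?\<mu> (dsgn Z) + t *\<^sub>R (d + \<rho>)"
    by (simp add: \<xi>4_def design_mean_mix algebra_simps)
  also have "\<dots> = ?\<mu> (dsgn Z')"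
    using t(1) by (simp add: \<rho>_def algebra_simps)
  finally have "loewner_le (info_matrix M \<xi>4) (info_matrix M (dsgn Z'))"
    by (rule domination[OF Z' designs(2)])
  then have "\<Phi> (info_matrix M \<xi>4) \<le> \<Phi> (info_matrix M (dsgn Z'))"
    using NND designs(2) domD(5)[OF Z'] by (intro isotonic) auto
  moreover have "v + t * gain \<le> \<Phi> (info_matrix M \<xi>4)"
  proof -
    have "(1 - \<eta>) * v1 + \<eta> * 0 \<le> (1 - \<eta>) * v1 + \<eta> * \<Phi> (info_matrix M \<xi>2)"
      using nonneg[OF NND[OF \<xi>2(1)]] \<eta>(1) by (intro add_left_mono mult_left_mono) auto
    also have "\<dots> \<le> \<Phi> (info_matrix M \<xi>3)"
      using concave_onD[OF concave, of \<eta> "info_matrix M \<zeta>" "info_matrix M \<xi>2"] NND[OF \<zeta>] NND[OF \<xi>2(1)] \<eta>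
      by (simp add: \<xi>3_def info_matrix_eq_mean design_mean_mix v1_def)
    finally have "v + gain \<le> \<Phi> (info_matrix M \<xi>3)"
      using gain(2) by simp
    then have "(1 - t) * v + t * (v + gain) \<le> (1 - t) * v + t * \<Phi> (info_matrix M \<xi>3)"
      using t(1) by (intro add_left_mono mult_left_mono) auto
    also have "\<dots> \<le> \<Phi> (info_matrix M \<xi>4)"
      using concave_onD[OF concave, of t "info_matrix M (dsgn Z)" "info_matrix M \<xi>3"]
        NND[OF domD(5)[OF Z]] NND[OF designs(1)] t
      by (simp add: \<xi>4_def info_matrix_eq_mean design_mean_mix v_def)
    finally show ?thesis
      by (simp add: algebra_simps)
  qed
  moreover have "\<Phi> (info_matrix M (dsgn Z')) - v \<le> t * gain / 2"
  proof -
    have nZ: "norm (Z' - Z) = t * norm D"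
      using t(1) by (simp add: Z'_def)
    have "t * norm D < t * (norm D + 1)"
      using t(1) by simp
    also have "\<dots> \<le> d2 / 2"
      using t(5) norm_D by (simp add: field_simps)
    also have "\<dots> < d2"
      using d2(1) by simp
    finally have "norm (objective L U M \<Phi> m Fix e Z' - objective L U M \<Phi> m Fix e Z - 0) \<le> \<epsilon> * (t * norm D)"
      using d2(2)[OF Z'] nZ by simp
    also have "\<dots> \<le> \<epsilon> * (t * (norm D + 1))"
      using \<open>0 < \<epsilon>\<close> t(1) by (intro mult_left_mono) auto
    also have "\<dots> = t * gain / 2"
    proof -
      have "gain / (2 * n) * (t * n) = t * gain / 2" if "0 < n" for n
        using that by (simp add: field_simps)
      from this[OF norm_D] show ?thesis
        unfolding \<epsilon>_def .
    qed
    finally have "\<bar>\<Phi> (info_matrix M (dsgn Z')) - v\<bar> \<le> t * gain / 2"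
      by (simp only: objective_def v_def real_norm_def diff_0_right)
    then show ?thesis
      by linarith
  qed
  moreover have "0 < t * gain"
    using t(1) gain(1) by simp
  ultimately show False by linarith
qed

end

lemma fixed_ends_of_complete_class:
  assumes "L < U" and mono: "strict_mono_on (design_space L U) c \<or> strict_antimono_on (design_space L U) c"
    and Fix: "Fix = (if lo then {A_end L U c} else {}) \<union> (if hi then {B_end L U c} else {})"
  shows "\<And>x. x \<in> design_space L U \<Longrightarrow>
      ereal x \<in> Fix \<longleftrightarrow> c x \<in> fixed_ends (c ` design_space L U) lo hi"
    and "\<And>Y. lo \<Longrightarrow> Y \<subseteq> design_space L U \<Longrightarrow> Fix \<subseteq> ereal ` Y \<Longrightarrow>
      \<exists>x\<in>Y. \<forall>t\<in>c ` design_space L U. c x \<le> t"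
    and "\<And>Y. hi \<Longrightarrow> Y \<subseteq> design_space L U \<Longrightarrow> Fix \<subseteq> ereal ` Y \<Longrightarrow>
      \<exists>x\<in>Y. \<forall>t\<in>c ` design_space L U. t \<le> c x"
proof -
  let ?X = "design_space L U"
  have A: "ereal x = A_end L U c \<longleftrightarrow> (\<forall>t\<in>c ` ?X. c x \<le> t)"
    and B: "ereal x = B_end L U c \<longleftrightarrow> (\<forall>t\<in>c ` ?X. t \<le> c x)" if x: "x \<in> ?X" for x
    using mono extremes_of_monotone_image[OF x, of c]
      design_space_least_iff[OF assms(1) x] design_space_greatest_iff[OF assms(1) x]
    unfolding A_end_def B_end_def by (cases "strict_mono_on ?X c"; simp)+
  show "ereal x \<in> Fix \<longleftrightarrow> c x \<in> fixed_ends (c ` ?X) lo hi" if "x \<in> ?X" for x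
  proof -
    have "ereal x \<in> Fix \<longleftrightarrow> lo \<and> ereal x = A_end L U c \<or> hi \<and> ereal x = B_end L U c"
      unfolding Fix by auto
    then show ?thesis
      unfolding A[OF that] B[OF that] fixed_ends_def using that by blast
  qed
  show "\<exists>x\<in>Y. \<forall>t\<in>c ` ?X. c x \<le> t" if "lo" "Y \<subseteq> ?X" "Fix \<subseteq> ereal ` Y" for Y
  proof -
    have "A_end L U c \<in> Fix" using that(1) by (simp add: Fix)
    with that(3) obtain x where x: "x \<in> Y" "ereal x = A_end L U c" by (metis imageE subsetD)
    then show ?thesis using A[of x] that(2) by blast
  qed
  show "\<exists>x\<in>Y. \<forall>t\<in>c ` ?X. t \<le> c x" if "hi" "Y \<subseteq> ?X" "Fix \<subseteq> ereal ` Y" for Y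
  proof -
    have "B_end L U c \<in> Fix" using that(1) by (simp add: Fix)
    with that(3) obtain x where x: "x \<in> Y" "ereal x = B_end L U c" by (metis imageE subsetD)
    then show ?thesis using B[of x] that(2) by blast
  qed
qed

text \<open>Hence the number of parameters is \<open>k - 1\<close>, the number of functions \<open>\<Psi>\<^sub>l\<close>.\<close>

lemma card_labelling:
  fixes e :: "nat + nat \<Rightarrow> 'z::finite"
  assumes "labelling L U m Fix e" "2 \<le> m"
  shows "CARD('z) = 2 * m - of_bool (L \<in> Fix) - of_bool (U \<in> Fix) - 1"
proof -
  have "nonfixed L U m Fix =
      {1..m} - ((if L \<in> Fix then {1} else {}) \<union> (if U \<in> Fix then {m} else {}))"
    by (auto simp: nonfixed_def)
  also have "card \<dots> = m - card ((if L \<in> Fix then {1} else {}) \<union> (if U \<in> Fix then {m} else {}))"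
    using assms(2) by (subst card_Diff_subset) auto
  also have "\<dots> = m - of_bool (L \<in> Fix) - of_bool (U \<in> Fix)"
    using assms(2) by (cases "L \<in> Fix"; cases "U \<in> Fix") simp_all
  finally have "card (nonfixed L U m Fix) = m - of_bool (L \<in> Fix) - of_bool (U \<in> Fix)" .
  moreover have "CARD('z) = card (nonfixed L U m Fix <+> {2..m})"
    using assms(1) bij_betw_same_card unfolding labelling_def by metis
  moreover have "finite (nonfixed L U m Fix)"
    by (simp add: nonfixed_def)
  ultimately show ?thesis
    using assms(2) by (simp add: card_Plus)
qed

theorem theorem2p2:
  fixes L U :: ereal
    and \<eta> :: "real \<Rightarrow> real^('p::finite + 'q::finite) \<Rightarrow> real"
    and \<theta> :: "real^('p + 'q)"
    and f :: "real \<Rightarrow> real^('p + 'q)"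
    and w :: "real \<Rightarrow> real"
    and \<Phi> :: "real^('p + 'q)^('p + 'q) \<Rightarrow> real"
    and m :: nat
    and Fix :: "ereal set"
    and e :: "nat + nat \<Rightarrow> 'z::finite"
    and Z :: "real^'z"
  assumes "L < U"
    and "model (design_space L U) \<eta> \<theta> f w"
    and "optimality_criterion \<Phi>"
    and "complete_class_hypothesis L U (fisher_info w f) m Fix"
    and "labelling L U m Fix e"
    and "feasible_critical_point L U (fisher_info w f) \<Phi> m Fix e Z"
  shows "optimal_design (design_space L U) (fisher_info w f) \<Phi> (design_of L U m Fix e Z)"
proof -
  let ?X = "design_space L U" and ?M = "fisher_info w f"
  have "CARD('p + 'q) \<le> m"
    using assms(4) unfolding complete_class_hypothesis_def by blast
  moreover have "CARD('p + 'q) = CARD('p) + CARD('q)"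
    by simp
  moreover have "0 < CARD('p)" "0 < CARD('q)"
    by (rule zero_less_card_finite)+
  ultimately have m: "2 \<le> m"
    by linarith
  obtain P and C :: "real \<Rightarrow> real^('p + 'q)^('p + 'q)" and c k \<Psi> h H where
    transf: "smooth_transformation ?X Fix c"
    and sym: "\<And>s. s \<in> c ` ?X \<Longrightarrow> transpose (C s) = C s"
    and M: "\<And>x. x \<in> ?X \<Longrightarrow> ?M x = P ** C (c x) ** transpose P"
    and entries: "maximal_indep_entries (c ` ?X) C k \<Psi>"
    and chain: "derivative_chain (c ` ?X) k \<Psi> (\<lambda>s. lower_block (C s)) h H"
    and cases: "k = 2 * m - 1 \<and> (\<forall>s\<in>c ` ?X. - F_matrix k h H s \<in> PD) \<and> Fix = {A_end L U c} \<or>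
           k = 2 * m - 1 \<and> (\<forall>s\<in>c ` ?X. F_matrix k h H s \<in> PD) \<and> Fix = {B_end L U c} \<or>
           k = 2 * m \<and> (\<forall>s\<in>c ` ?X. - F_matrix k h H s \<in> PD) \<and> Fix = {} \<or>
           k = 2 * m - 2 \<and> (\<forall>s\<in>c ` ?X. F_matrix k h H s \<in> PD) \<and> Fix = {L, U}"
    using assms(4) unfolding complete_class_hypothesis_def Let_def by blast
  have ends: "{A_end L U c, B_end L U c} = {L, U}" "A_end L U c \<noteq> B_end L U c"
    using \<open>L < U\<close> by (auto simp: A_end_def B_end_def)
  obtain lo hi where k: "k = 2 * m - of_bool lo - of_bool hi"
    and F: "\<And>s. s \<in> c ` ?X \<Longrightarrow> (if hi then F_matrix k h H s else - F_matrix k h H s) \<in> PD"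
    and Fix: "Fix = (if lo then {A_end L U c} else {}) \<union> (if hi then {B_end L U c} else {})"
  proof -
    note thesis_of = that
    from cases show thesis
    proof (elim disjE conjE)
      assume "k = 2 * m - 1" "\<forall>s\<in>c ` ?X. - F_matrix k h H s \<in> PD" "Fix = {A_end L U c}"
      then show thesis by (intro thesis_of[of True False]) auto
    next
      assume "k = 2 * m - 1" "\<forall>s\<in>c ` ?X. F_matrix k h H s \<in> PD" "Fix = {B_end L U c}"
      then show thesis by (intro thesis_of[of False True]) auto
    next
      assume "k = 2 * m" "\<forall>s\<in>c ` ?X. - F_matrix k h H s \<in> PD" "Fix = {}"
      then show thesis by (intro thesis_of[of False False]) auto
    next
      assume "k = 2 * m - 2" "\<forall>s\<in>c ` ?X. F_matrix k h H s \<in> PD" "Fix = {L, U}"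
      then show thesis using ends(1) by (intro thesis_of[of True True]) auto
    qed
  qed
  obtain c' where mono: "strict_mono_on ?X c \<or> strict_antimono_on ?X c"
    and c': "\<And>x. x \<in> ?X \<Longrightarrow> (c has_real_derivative c' x) (at x within ?X)"
    and nz: "\<And>x. x \<in> ?X \<Longrightarrow> ereal x \<notin> Fix \<Longrightarrow> c' x \<noteq> 0"
    using transf unfolding smooth_transformation_def by blast
  have "of_bool (L \<in> Fix) + of_bool (U \<in> Fix) = (of_bool lo + of_bool hi :: nat)"
    using ends \<open>L < U\<close> unfolding Fix by (auto simp: doubleton_eq_iff)
  then have "CARD('z) = k - 1"
    using card_labelling[OF assms(5) m] k by simp
  then obtain \<pi> :: "nat \<Rightarrow> 'z" where \<pi>: "bij_betw \<pi> {1..<k} UNIV"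
    using finite_same_card_bij[of "{1..<k}" "UNIV :: 'z set"] by auto
  have continuous: "continuous_on ?X c"
    using c' by (rule DERIV_continuous_on)
  have inj: "inj_on c ?X"
    using mono by (auto simp: strict_mono_on_imp_inj_on strict_antimono_iff_antimono)
  have interval: "is_interval (c ` ?X)"
    using connected_continuous_image[OF continuous] is_interval_design_space[of L U]
    by (simp add: is_interval_connected_1)
  have infinite: "infinite (c ` ?X)"
    using infinite_design_space[OF \<open>L < U\<close>] inj by (simp add: finite_image_iff)
  have nonzero: "h l l s \<noteq> 0" if "l \<in> {1..<k}" "s \<in> c ` ?X" for l s
  proof
    assume "h l l s = 0"
    with that(1) have "F_matrix k h H s = 0"
      by (auto simp: F_matrix_def)
    moreover have "(1 :: real^'q) \<noteq> 0"
      by (simp add: vec_eq_iff)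
    ultimately show False
      using F[OF that(2)] by (auto simp: PD_def split: if_splits)
  qed
  have NND: "?M x \<in> NND" if "x \<in> ?X" for x
    using assms(2) that by (intro fisher_info_NND) (auto simp: model_def)
  interpret complete_class L U c k \<Psi> h lo hi m \<pi> ?M C P H Fix c' e
  proof unfold_locales
    show "Fix \<subseteq> {L, U}"
      using ends(1) unfolding Fix by (auto split: if_splits)
    show "1 \<le> k"
      using k m by (cases lo; cases hi) simp_all
    show "(\<Psi> l has_real_derivative h l 1 s) (at s within c ` ?X)" if "l \<in> {1..<k}" "s \<in> c ` ?X" for l s
      using chain that unfolding derivative_chain_def by blast
    show "((\<lambda>u. h l (t - 1) u / h (t - 1) (t - 1) u) has_real_derivative h l t s) (at s within c ` ?X)"
      if "l \<in> {1..<k}" "t \<in> {2..l}" "s \<in> c ` ?X" for l t s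
      using chain that unfolding derivative_chain_def by blast
  qed (fact \<open>L < U\<close> sym M entries chain F k mono c' nz m \<pi> interval infinite nonzero NND assms(5)
      fixed_ends_of_complete_class[OF \<open>L < U\<close> mono Fix])+
  have feasible: "Z \<in> dom" "(objective L U ?M \<Phi> m Fix e has_derivative (\<lambda>_. 0)) (at Z within dom)"
    "\<And>i. i \<in> {2..m} \<Longrightarrow> 0 < Z $ e (Inr i)" "(\<Sum>i=2..m. Z $ e (Inr i)) < 1"
    using assms(6) by (auto simp: feasible_critical_point_def)
  have "0 < wt Z i" if "i \<in> {1..m}" for i
    using feasible(3)[of i] feasible(4) that by (auto simp: weight_of_def)
  moreover have "dsgn Z \<in> designs X"
    by (rule domD(5)[OF feasible(1)])
  ultimately show ?thesis
    using assms(3) critical_point_optimal[OF _ _ _ feasible(1) _ feasible(2)]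
    unfolding optimal_design_def optimality_criterion_def by blast
qed

end
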